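(* Let $n,d,r$ be integers with $n,d\geq 2$ and $1\leq r\leq d/2$. Let $q=p^n$, where $p$ is a prime such that $q \equiv -1 \pmod d$ and \[ p\geq \frac{(4n-1)^2 rd^2}{(d-r)^2}. \] Let $H$ be the subgroup of $\mathbb{F}_{q^2}^*$ with index $d$. Let $S$ be a union of $r$ cosets of $H$ in $\mathbb{F}_{q^2}^*$ such that $\mathbb{F}_q^* \subseteq S$. If $A \subseteq \mathbb{F}_{q^2}$ is such that $0,1\in A$, $|A|=q$, and $A-A \subseteq S \cup \{0\}$, then $A=\mathbb{F}_q$.
   Context: $\mathbb{F}_q$ denotes the finite field with $q$ elements, regarded as the unique subfield of order $q$ of the field $\mathbb{F}_{q^2}$ with $q^2$ elements; $\mathbb{F}_q^*=\mathbb{F}_q\setminus\{0\}$ and $\mathbb{F}_{q^2}^*=\mathbb{F}_{q^2}\setminus\{0\}$ are the multiplicative groups. $A-A=\{a-b: a,b\in A\}$. *)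

theory Defs
  imports
    "HOL-Algebra.Algebra"
    "HOL-Algebra.Algebraic_Closure_Type"
    "HOL-Number_Theory.Cong"
begin

text \<open>
  The multiplicative group of non-zero elements of a field given as a type; going through
  \<^const>\<open>ring_of_type_algebra\<close> makes the HOL-Algebra notions of subgroup and coset available.
\<close>

definition mult_group :: "'a::field monoid" where
  "mult_group = Multiplicative_Group.mult_of ring_of_type_algebra"

end

theory Submission
  imports Defs "HOL-Computational_Algebra.Computational_Algebra"
begin

text \<open>
  Write \<open>u = (q + 1) / d\<close> and \<open>T\<close> for the image of \<open>S\<close> under \<open>y \<mapsto> y ^ ((q - 1) u)\<close>, which has at most
  \<open>r\<close> elements. View the field as an affine plane over \<open>Fq\<close>. The direction \<open>v = z ^ (1 - q)\<close> of a
  difference \<open>z\<close> of two points of \<open>A\<close> satisfies \<open>1 / v ^ u \<in> T\<close>, so \<open>A\<close> determines at most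
  \<open>r u \<le> (q + 1) / 2\<close> directions. By the theorem of Ball, Blokhuis, Brouwer, Storme and
  Szonyi on sets with few directions (proved here through lacunary Redei polynomials), \<open>A\<close> is
  closed under addition. If \<open>A \<noteq> Fq\<close>, a count of subspaces gives a point \<open>a\<close> of \<open>A\<close> with \<open>2 n\<close> distinct
  conjugates over the prime field. All \<open>x + a\<close> with \<open>x\<close> in the prime field lie in \<open>S\<close>, so the map
  \<open>x \<mapsto> (x + a) ^ ((q - 1) u)\<close> takes at most \<open>r\<close> instead of \<open>d\<close> values there. Stepanov's method, applied to
  all of these values at once, shows that this is impossible for large \<open>p\<close>.
\<close>

subsection \<open>Finite fields and products of linear polynomials\<close>

text \<open>Multiplication by \<open>x\<close> permutes \<open>B\<close>; compare the products over
  \<open>B\<close> before and after. This serves the full multiplicative group, \<open>H\<close> and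
  \<open>Fq - {0}\<close> alike.\<close>

lemma power_card_eq_1:
  fixes B :: "'a::field set"
  assumes "finite B" "0 \<notin> B" "\<And>x y. x \<in> B \<Longrightarrow> y \<in> B \<Longrightarrow> x * y \<in> B" "x \<in> B"
  shows "x ^ card B = 1"
proof -
  have inj: "inj_on ((*) x) B"
    using assms by (auto intro!: inj_onI)
  then have "(*) x ` B = B"
    using assms by (intro card_subset_eq) (auto simp: card_image)
  then have "(\<Prod>y\<in>B. y) = (\<Prod>y\<in>B. x * y)"
    using prod.reindex[OF inj, of "\<lambda>y. y"] by simp
  also have "\<dots> = x ^ card B * (\<Prod>y\<in>B. y)"
    by (simp add: prod.distrib)
  finally show ?thesis
    using assms by (simp add: prod_zero_iff)
qed

lemma field_power_card_eq_same:
  fixes x :: "'a :: {field, finite}"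
  shows "x ^ card (UNIV :: 'a set) = x"
proof (cases "x = 0")
  case False
  have "x ^ card (UNIV :: 'a set) = x * x ^ card (UNIV - {0 :: 'a})"
    by (simp add: card_Suc_Diff1 del: card_Diff_insert flip: power_Suc)
  also have "x ^ card (UNIV - {0 :: 'a}) = 1"
    using False by (intro power_card_eq_1) auto
  finally show ?thesis
    by simp
qed (simp add: power_0_left)

lemma CHAR_eq_if_card_prime_power:
  assumes "Factorial_Ring.prime p" "card (UNIV :: 'a::{field, finite} set) = p ^ k"
  shows "CHAR('a) = p"
proof -
  have "(\<Sum>x\<in>(UNIV :: 'a set). x + 1) = \<Sum>UNIV"
    by (rule sum.reindex_bij_witness[of _ "\<lambda>x. x - 1" "\<lambda>x. x + 1"]) auto
  then have "of_nat (card (UNIV :: 'a set)) = (0 :: 'a)"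
    by (simp add: sum.distrib)
  then have "CHAR('a) dvd p ^ k"
    using assms(2) of_nat_eq_0_iff_char_dvd by metis
  moreover have "Factorial_Ring.prime CHAR('a)"
    using finite_imp_CHAR_pos[where ?'a = 'a] prime_CHAR_semidom by auto
  ultimately show ?thesis
    using assms(1) by (metis prime_dvd_power primes_dvd_imp_eq)
qed

lemma lead_coeff_prod_linear:
  "finite A \<Longrightarrow> lead_coeff (\<Prod>a\<in>A. [:- f a, 1:]) = (1::'a::idom)"
  by (simp add: lead_coeff_prod)

lemma degree_prod_linear:
  "finite A \<Longrightarrow> degree (\<Prod>a\<in>A. [:- f a, 1:]) = card A" for f :: "'b \<Rightarrow> 'a::idom"
  by (subst degree_prod_sum_eq) auto

lemma prod_linear_dvd:
  fixes P :: "'a::idom poly"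
  assumes "finite B" "\<And>b. b \<in> B \<Longrightarrow> poly P b = 0"
  shows "(\<Prod>b\<in>B. [:-b, 1:]) dvd P"
  using assms
proof (induction B arbitrary: P rule: finite_induct)
  case (insert c B)
  then obtain P' where P: "P = [:-c, 1:] * P'"
    by (metis dvdE insertI1 poly_eq_0_iff_dvd)
  have "poly P' b = 0" if "b \<in> B" for b
    using insert.prems[of b] insert.hyps that unfolding P by auto
  then have "(\<Prod>b\<in>B. [:-b, 1:]) dvd P'"
    by (rule insert.IH)
  then show ?case
    unfolding P prod.insert[OF insert.hyps] by (rule mult_dvd_mono[OF dvd_refl])
qed auto

text \<open>Each summand of the derivative misses one linear factor, which \<open>P\<close>
  supplies. The values of \<open>f\<close> may repeat.\<close>

lemma prod_linear_dvd_mult_pderiv: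
  fixes P :: "'a::idom poly"
  assumes "finite A" "\<And>a. a \<in> A \<Longrightarrow> poly P (f a) = 0"
  shows "(\<Prod>a\<in>A. [:- f a, 1:]) dvd P * pderiv (\<Prod>a\<in>A. [:- f a, 1:])"
proof -
  have "(\<Prod>a\<in>A. [:- f a, 1:]) dvd P * (\<Prod>b\<in>A-{a}. [:- f b, 1:])" if "a \<in> A" for a
  proof -
    have "(\<Prod>a\<in>A. [:- f a, 1:]) = [:- f a, 1:] * (\<Prod>b\<in>A-{a}. [:- f b, 1:])"
      using that assms by (simp add: prod.remove)
    moreover have "[:- f a, 1:] dvd P"
      using assms that by (simp add: poly_eq_0_iff_dvd)
    ultimately show ?thesis
      by (simp only: mult_dvd_mono dvd_refl)
  qed
  then show ?thesis
    by (simp add: pderiv_prod pderiv_pCons sum_distrib_left dvd_sum)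
qed

lemma poly_pderiv_prod_linear:
  fixes f :: "'b \<Rightarrow> 'a::idom"
  assumes "finite A" "a \<in> A"
  shows "poly (pderiv (\<Prod>a\<in>A. [:- f a, 1:])) (f a) = (\<Prod>b\<in>A-{a}. f a - f b)"
proof -
  have "(\<Prod>a\<in>A. [:- f a, 1:]) = [:- f a, 1:] * (\<Prod>b\<in>A-{a}. [:- f b, 1:])"
    using assms by (simp add: prod.remove)
  then show ?thesis
    by (simp only: pderiv_mult) (simp add: pderiv_pCons poly_prod)
qed

text \<open>The coefficient is the elementary symmetric polynomial of degree
  \<open>card A - k\<close> in the \<open>c a\<close>, each of degree at most
  \<open>1\<close>.\<close>

lemma degree_coeff_prod_linear_le:
  fixes c :: "'b \<Rightarrow> 'a::idom poly"
  assumes "finite A" "\<And>a. a \<in> A \<Longrightarrow> degree (c a) \<le> 1" "k \<le> card A"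
  shows "degree (coeff (\<Prod>a\<in>A. [:c a, 1:]) k) \<le> card A - k"
  using assms
proof (induction A arbitrary: k rule: finite_induct)
  case (insert x A)
  let ?P = "\<Prod>a\<in>A. [:c a, 1:]"
  have eq: "coeff (\<Prod>a\<in>insert x A. [:c a, 1:]) k
      = c x * coeff ?P k + (if k = 0 then 0 else coeff ?P (k - 1))"
    using insert.hyps by (cases k) (auto simp: mult_pCons_left)
  have degP: "degree ?P = card A"
    using degree_prod_linear[OF insert.hyps(1), of "\<lambda>a. - c a"] by simp
  have "degree (c x * coeff ?P k) \<le> Suc (card A) - k"
  proof (cases "k \<le> card A")
    case True
    have "degree (c x * coeff ?P k) \<le> degree (c x) + degree (coeff ?P k)"
      by (rule degree_mult_le)
    also have "\<dots> \<le> 1 + (card A - k)"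
      using insert.prems(1)[of x] insert.IH[of k] insert.prems True by (intro add_mono) auto
    finally show ?thesis
      using True by simp
  next
    case False
    then show ?thesis
      using degP by (simp add: coeff_eq_0)
  qed
  moreover have "degree (if k = 0 then 0 else coeff ?P (k - 1)) \<le> Suc (card A) - k"
    using insert.IH[of "k - 1"] insert.prems insert.hyps by (cases k) auto
  ultimately show ?case
    unfolding eq using insert.hyps by (simp add: degree_add_le)
qed auto

lemma poly_coeff_prod_linear:
  fixes c :: "'b \<Rightarrow> 'a::idom poly"
  assumes "finite A"
  shows "poly (coeff (\<Prod>a\<in>A. [:c a, 1:]) k) v = coeff (\<Prod>a\<in>A. [:poly (c a) v, 1:]) k"
  using assms
proof (induction A arbitrary: k rule: finite_induct)
  case (insert x A)
  then show ?case
    by (cases k) (auto simp: mult_pCons_left)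
qed (auto simp: coeff_pCons split: nat.splits)

text \<open>Pigeonhole: there are more assignments on \<open>U\<close> than families of values on
  \<open>E\<close>, and the difference of two assignments with the same values is a
  solution.\<close>

lemma exists_nontrivial_solution:
  fixes M :: "'e \<Rightarrow> 'u \<Rightarrow> 'a::{field, finite}"
  assumes "finite U" "finite E" "card E < card U"
  obtains y where "\<exists>u\<in>U. y u \<noteq> 0" "\<And>e. e \<in> E \<Longrightarrow> (\<Sum>u\<in>U. M e u * y u) = 0"
proof -
  let ?F = "\<lambda>y. restrict (\<lambda>e. \<Sum>u\<in>U. M e u * y u) E"
  let ?Y = "U \<rightarrow>\<^sub>E (UNIV :: 'a set)"
  have "card (UNIV :: 'a set) > 1"
    using card_mono[of UNIV "{0, 1 :: 'a}"] by simp
  then have "card (E \<rightarrow>\<^sub>E (UNIV :: 'a set)) < card ?Y"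
    using assms by (simp add: card_PiE power_strict_increasing)
  moreover have "?F ` ?Y \<subseteq> E \<rightarrow>\<^sub>E UNIV"
    by auto
  moreover have "finite (E \<rightarrow>\<^sub>E (UNIV :: 'a set))"
    using assms by (intro finite_PiE) auto
  ultimately have "\<not> inj_on ?F ?Y"
    by (meson card_inj_on_le not_le)
  then obtain y z where yz: "y \<in> ?Y" "z \<in> ?Y" "y \<noteq> z" "?F y = ?F z"
    by (auto simp: inj_on_def)
  show ?thesis
  proof (rule that[of "\<lambda>u. y u - z u"])
    show "\<exists>u\<in>U. y u - z u \<noteq> 0"
    proof (rule ccontr)
      assume "\<not> ?thesis"
      then have "y u = z u" if "u \<in> U" for u
        using that by auto
      then have "y = z"
        using yz by (intro PiE_ext[of y U _ z]) auto
      then show False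
        using yz by simp
    qed
    show "(\<Sum>u\<in>U. M e u * (y u - z u)) = 0" if "e \<in> E" for e
    proof -
      have "(\<Sum>u\<in>U. M e u * y u) = (\<Sum>u\<in>U. M e u * z u)"
        using fun_cong[OF yz(4), of e] that by simp
      then show ?thesis
        by (simp add: right_diff_distrib sum_subtractf)
    qed
  qed
qed

subsection \<open>Directions determined by a set of \<open>q\<close> points\<close>

lemma card_power_roots_le:
  fixes c :: "'a::{field, finite}"
  assumes "m > 0"
  shows "card {x. x ^ m = c} \<le> m"
proof -
  let ?P = "monom 1 m - [:c:] :: 'a poly"
  have "coeff ?P m = 1"
    using assms by (cases m) auto
  then have "?P \<noteq> 0"
    by (metis coeff_0 zero_neq_one)
  moreover have "degree ?P \<le> m"
    by (intro degree_diff_le degree_monom_le) auto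
  moreover have "{x. x ^ m = c} = {x. poly ?P x = 0}"
    by (simp add: poly_monom)
  ultimately show ?thesis
    using card_poly_roots_bound[of ?P] by simp
qed

lemma order_prod:
  assumes "finite B" "\<And>b. b \<in> B \<Longrightarrow> f b \<noteq> 0"
  shows "order v (\<Prod>b\<in>B. f b) = (\<Sum>b\<in>B. order v (f b :: 'a::idom poly))"
  using assms by (induction B rule: finite_induct) (auto simp: order_mult)

lemma order_linear:
  fixes x y v :: "'a::field"
  assumes "x \<noteq> 0 \<or> y \<noteq> 0"
  shows "order v [:x, y:] = (if x + v * y = 0 then 1 else 0)"
proof (cases "x + v * y = 0")
  case True
  then have "y \<noteq> 0"
    using assms by auto
  moreover have "[:x, y:] = smult y ([:-v, 1:] ^ 1)"
    using True by (simp add: eq_neg_iff_add_eq_0 mult.commute)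
  ultimately have "order v [:x, y:] = 1"
    by (metis order_smult order_power_n_n)
  then show ?thesis
    using True by simp
next
  case False
  then show ?thesis
    by (simp add: order_0I)
qed

section \<open>The field of order \<open>q^2\<close>, its Frobenius maps and its directions over the
  subfield of order \<open>q\<close>\<close>

locale quadratic_field =
  fixes p n q :: nat and A :: "'a::{field, finite} set"
  assumes prime_p: "Factorial_Ring.prime p"
    and n_pos: "n > 0"
    and q_eq: "q = p ^ n"
    and card_UNIV: "card (UNIV :: 'a set) = q\<^sup>2"
    and card_A: "card A = q"
begin

lemma CHAR_p: "CHAR('a) = p"
  using CHAR_eq_if_card_prime_power[of p "n * 2"] prime_p card_UNIV q_eq
  by (simp add: power_mult)

lemma p_gt_1: "p > 1"
  using prime_p by (rule prime_gt_1_nat)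

lemma q_gt_1: "q > 1"
  using p_gt_1 n_pos unfolding q_eq by (metis one_less_power)

lemma of_nat_power_p: "e > 0 \<Longrightarrow> of_nat (p ^ e) = (0 :: 'a)"
  by (simp add: of_nat_eq_0_iff_char_dvd CHAR_p)

lemma of_nat_q: "of_nat q = (0 :: 'a)"
  using of_nat_power_p[OF n_pos] by (simp add: q_eq)

lemma add_power_p: "(x + y :: 'a) ^ (p ^ e) = x ^ (p ^ e) + y ^ (p ^ e)"
  by (rule freshmans_dream'[where n = e]) (simp_all add: CHAR_p prime_p)

lemma diff_power_p: "(x - y :: 'a) ^ (p ^ e) = x ^ (p ^ e) - y ^ (p ^ e)"
  using add_power_p[of "x - y" y e] by simp

lemma add_power_q: "(x + y :: 'a) ^ q = x ^ q + y ^ q"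
  unfolding q_eq by (rule add_power_p)

lemma diff_power_q: "(x - y :: 'a) ^ q = x ^ q - y ^ q"
  unfolding q_eq by (rule diff_power_p)

lemma poly_add_power_p: "(x + y :: 'a poly) ^ (p ^ e) = x ^ (p ^ e) + y ^ (p ^ e)"
  by (rule freshmans_dream'[where n = e]) (simp_all add: CHAR_p prime_p)

lemma poly_diff_power_p: "(x - y :: 'a poly) ^ (p ^ e) = x ^ (p ^ e) - y ^ (p ^ e)"
  using poly_add_power_p[of "x - y" y e] by simp

lemma power_q_q: "(x ^ q) ^ q = (x :: 'a)"
  using field_power_card_eq_same[of x] card_UNIV by (simp add: power2_eq_square power_mult)

lemma power_order: "x \<noteq> (0 :: 'a) \<Longrightarrow> x ^ (q\<^sup>2 - 1) = 1"
proof -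
  assume "x \<noteq> 0"
  have "x * x ^ (q\<^sup>2 - 1) = x ^ q\<^sup>2"
    using q_gt_1 by (simp flip: power_Suc)
  also have "\<dots> = x"
    using field_power_card_eq_same[of x] card_UNIV by simp
  finally show ?thesis
    using \<open>x \<noteq> 0\<close> by simp
qed

lemma finite_A: "finite A"
  by simp

definition mu :: "'a set" where
  "mu = {v. v ^ (q + 1) = 1}"

lemma mu_nonzero: "v \<in> mu \<Longrightarrow> v \<noteq> 0"
  by (auto simp: mu_def)

lemma mu_power_q: "v \<in> mu \<Longrightarrow> v ^ q = inverse v"
  using mu_nonzero[of v] by (simp add: mu_def field_simps)

lemma slope_in_mu:
  assumes "z \<noteq> (0 :: 'a)"
  shows "z / z ^ q \<in> mu"
proof -
  have "(z / z ^ q) ^ q * (z / z ^ q) = z ^ q / z * (z / z ^ q)"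
    using power_q_q[of z] by (simp only: power_divide)
  also have "\<dots> = 1"
    using assms by simp
  finally show ?thesis
    by (simp add: mu_def mult.commute)
qed

text \<open>The upper bound counts roots. For the lower bound,
  \<open>x \<mapsto> x ^ (q - 1)\<close> sends the \<open>q^2 - 1\<close> nonzero elements into
  \<open>mu\<close> with fibres of size at most \<open>q - 1\<close>.\<close>

lemma card_mu: "card mu = q + 1"
proof (rule antisym)
  show "card mu \<le> q + 1"
    unfolding mu_def by (rule card_power_roots_le) simp
  have q2: "q\<^sup>2 - 1 = (q - 1) * (q + 1)"
    using q_gt_1 by (simp add: algebra_simps power2_eq_square diff_mult_distrib2)
  have "UNIV - {0 :: 'a} \<subseteq> (\<Union>v\<in>mu. {x. x ^ (q - 1) = v})"
  proof
    fix x :: 'a assume "x \<in> UNIV - {0}"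
    then have "x ^ (q - 1) \<in> mu"
      using power_order[of x] by (simp only: mu_def mem_Collect_eq q2 DiffD2 singleton_iff power_mult) simp
    then show "x \<in> (\<Union>v\<in>mu. {x. x ^ (q - 1) = v})"
      by blast
  qed
  then have "card (UNIV - {0 :: 'a}) \<le> card (\<Union>v\<in>mu. {x. x ^ (q - 1) = v})"
    by (intro card_mono) auto
  also have "\<dots> \<le> (\<Sum>v\<in>mu. card {x. x ^ (q - 1) = v})"
    by (rule card_UN_le) simp
  also have "\<dots> \<le> (\<Sum>v\<in>mu. q - 1)"
    using q_gt_1 by (intro sum_mono card_power_roots_le) simp
  finally have "q\<^sup>2 - 1 \<le> card mu * (q - 1)"
    by (simp add: card_Diff_singleton card_UNIV)
  then show "q + 1 \<le> card mu"
    using q_gt_1 unfolding q2 by (metis mult.commute mult_le_cancel2 zero_less_diff)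
qed

text \<open>
  The direction of \<open>z \<noteq> 0\<close> is encoded as \<open>z / z ^ q \<in> mu\<close>; the functional \<open>ell v\<close> is linear over the
  subfield of order \<open>q\<close>, and its kernel is the line with direction \<open>v\<close>.
\<close>
definition ell :: "'a \<Rightarrow> 'a \<Rightarrow> 'a" where
  "ell v a = a - v * a ^ q"

lemma ell_diff: "ell v (a - b) = ell v a - ell v b"
  by (simp add: ell_def diff_power_q algebra_simps)

lemma ell_add: "ell v (a + b) = ell v a + ell v b"
  by (simp add: ell_def add_power_q algebra_simps)

lemma ell_0 [simp]: "ell v 0 = 0"
  using q_gt_1 by (simp add: ell_def)

lemma ell_eq_0_iff: "z \<noteq> 0 \<Longrightarrow> ell v z = 0 \<longleftrightarrow> v = z / z ^ q"
  by (auto simp: ell_def field_simps)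

text \<open>This places all values of \<open>ell v\<close> among the roots of
  \<open>X ^ q + X / v\<close>, with which the Redei polynomial is compared below.\<close>

lemma ell_power_q:
  assumes "v \<in> mu"
  shows "ell v a ^ q = - inverse v * ell v a"
proof -
  have "ell v a ^ q = a ^ q - inverse v * a"
    using mu_power_q[OF assms]
    by (simp add: ell_def diff_power_q power_mult_distrib power_q_q)
  then show ?thesis
    using mu_nonzero[OF assms] by (simp add: ell_def field_simps)
qed

text \<open>A collision of \<open>ell v\<close> on \<open>A\<close> means two points of
  \<open>A\<close> on one line of direction \<open>v\<close>, so these are the directions determined
  by \<open>A\<close>.\<close>

definition D :: "'a set" where
  "D = {v \<in> mu. \<not> inj_on (ell v) A}"

lemma D_iff: "v \<in> D \<longleftrightarrow> (\<exists>a\<in>A. \<exists>b\<in>A. a \<noteq> b \<and> v = (a - b) / (a - b) ^ q)"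
proof
  assume "v \<in> D"
  then obtain a b where "a \<in> A" "b \<in> A" "a \<noteq> b" "ell v (a - b) = 0"
    by (auto simp: D_def inj_on_def ell_diff)
  then show "\<exists>a\<in>A. \<exists>b\<in>A. a \<noteq> b \<and> v = (a - b) / (a - b) ^ q"
    using ell_eq_0_iff[of "a - b" v] by auto
next
  assume "\<exists>a\<in>A. \<exists>b\<in>A. a \<noteq> b \<and> v = (a - b) / (a - b) ^ q"
  then obtain a b where *: "a \<in> A" "b \<in> A" "a \<noteq> b" "v = (a - b) / (a - b) ^ q"
    by auto
  then have "ell v a = ell v b"
    using ell_eq_0_iff[of "a - b" v] by (simp add: ell_diff)
  then show "v \<in> D"
    using * slope_in_mu[of "a - b"] by (auto simp: D_def inj_on_def)
qed

lemma D_subset: "D \<subseteq> mu"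
  by (auto simp: D_def)

section \<open>Redei polynomials of \<open>A\<close>, specialised at a direction\<close>

definition R :: "'a \<Rightarrow> 'a poly" where
  "R v = (\<Prod>a\<in>A. [:- ell v a, 1:])"

lemma degree_R: "degree (R v) = q"
  unfolding R_def by (simp add: degree_prod_linear card_A)

lemma coeff_R_q: "coeff (R v) q = 1"
  using lead_coeff_prod_linear[of A "ell v"] degree_R[of v] by (simp add: R_def)

text \<open>Off \<open>D\<close> the \<open>q\<close> values of \<open>ell v\<close> on
  \<open>A\<close> are distinct, so two monic polynomials of degree \<open>q\<close> agree at
  \<open>q\<close> points.\<close>

lemma R_eq_if_not_D:
  assumes "v \<in> mu" "v \<notin> D"
  shows "R v = monom 1 q + [:0, inverse v:]"
proof (rule poly_eqI_degree_lead_coeff[of _ q _ "ell v ` A"])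
  show "coeff (R v) q = coeff (monom 1 q + [:0, inverse v:]) q"
    using q_gt_1 by (simp add: coeff_R_q coeff_pCons split: nat.splits)
  show "card (ell v ` A) \<ge> q"
    using assms by (simp add: D_def card_image card_A)
  show "degree (R v) \<le> q"
    by (simp add: degree_R)
  show "degree (monom 1 q + [:0, inverse v:]) \<le> q"
    using q_gt_1 by (intro degree_add_le degree_monom_le) simp
  fix z assume "z \<in> ell v ` A"
  then obtain a where "a \<in> A" "z = ell v a"
    by auto
  then show "poly (R v) z = poly (monom 1 q + [:0, inverse v:]) z"
    using ell_power_q[OF assms(1), of a]
    by (auto simp: R_def poly_prod poly_monom prod_zero_iff[OF finite_A])
qed

text \<open>
  As a polynomial in \<open>v\<close>, the coefficient has degree at most \<open>q - k\<close>, and it vanishes outside \<open>D\<close>.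
\<close>
lemma coeff_R_eq_0:
  assumes "v \<in> mu" "card D \<le> k" "2 \<le> k" "k < q"
  shows "coeff (R v) k = 0"
proof -
  let ?c = "\<lambda>a. [:- a, a ^ q:]"
  let ?s = "coeff (\<Prod>a\<in>A. [:?c a, 1:]) k"
  have eval: "poly ?s w = coeff (R w) k" for w
    using poly_coeff_prod_linear[OF finite_A, of ?c k w] by (simp add: R_def ell_def)
  have deg: "degree ?s \<le> q - k"
    using degree_coeff_prod_linear_le[OF finite_A, of ?c k] assms card_A by simp
  have card: "card (mu - D) = q + 1 - card D"
    using card_mu D_subset by (simp add: card_Diff_subset)
  have "?s = 0"
  proof (rule poly_eqI_degree)
    fix w assume "w \<in> mu - D"
    then have "coeff (R w) k = 0"
      using assms by (simp add: R_eq_if_not_D coeff_pCons split: nat.splits)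
    then show "poly ?s w = poly 0 w"
      by (simp add: eval)
  next
    show "degree ?s < card (mu - D)" "degree (0 :: 'a poly) < card (mu - D)"
      using deg card assms by auto
  qed
  then show ?thesis
    using eval[of v] by simp
qed

end

lemma degree_pderiv_le: "degree (pderiv P) \<le> degree P - 1"
  by (rule degree_le) (auto simp: coeff_pderiv coeff_eq_0)

locale few_directions = quadratic_field +
  assumes p_ge_3: "p \<ge> 3"
    and zero_in_A: "0 \<in> A"
    and card_D_ge_2: "card D \<ge> 2"
    and card_D_le: "2 * card D \<le> q + 1"
begin

text \<open>The low part of the lacunary polynomial \<open>R v\<close>. It carries the whole
  derivative, since \<open>X ^ q\<close> has derivative zero.\<close>

definition g :: "'a \<Rightarrow> 'a poly" where
  "g v = R v - monom 1 q"

lemma degree_g: "v \<in> mu \<Longrightarrow> degree (g v) \<le> card D - 1"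
proof (rule degree_le, intro allI impI)
  fix k assume "v \<in> mu" "k > card D - 1"
  then show "coeff (g v) k = 0"
    using coeff_R_eq_0[of v k] coeff_R_q[of v] card_D_ge_2 degree_R[of v]
    by (cases k q rule: linorder_cases) (auto simp: g_def coeff_eq_0)
qed

lemma pderiv_R: "pderiv (R v) = pderiv (g v)"
  by (simp add: g_def pderiv_diff pderiv_monom of_nat_q)

lemma pderiv_R_not_D:
  assumes "v \<in> mu" "v \<notin> D"
  shows "pderiv (R v) = [:inverse v:]"
  using assms by (simp add: R_eq_if_not_D pderiv_add pderiv_monom of_nat_q pderiv_pCons)

text \<open>All roots of \<open>R v\<close> are roots of \<open>X ^ q + X / v\<close>, so
  \<open>R v\<close> divides \<open>(X ^ q + X / v) * pderiv (R v)\<close>, hence also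
  \<open>h * pderiv (R v)\<close>, whose degree is at most \<open>2 * card D - 3 < q\<close>. The
  case \<open>h = 0\<close> would make \<open>R v\<close> separable, against the collision in
  direction \<open>v\<close>.\<close>

lemma pderiv_R_D:
  assumes "v \<in> D"
  shows "pderiv (R v) = 0"
proof (rule ccontr)
  assume nz: "pderiv (R v) \<noteq> 0"
  have v: "v \<in> mu"
    using assms D_subset by auto
  define h where "h = [:0, inverse v:] - g v"
  have Z: "monom 1 q + [:0, inverse v:] = R v + h"
    by (simp add: h_def g_def)
  have "R v dvd (monom 1 q + [:0, inverse v:]) * pderiv (R v)"
    unfolding R_def
    by (rule prod_linear_dvd_mult_pderiv) (use ell_power_q[OF v] in \<open>simp_all add: poly_monom\<close>)
  then have dvd: "R v dvd h * pderiv (R v)"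
    unfolding Z by (simp add: distrib_right dvd_add_right_iff)
  have "h \<noteq> 0"
  proof
    assume "h = 0"
    then have "pderiv (R v) = pderiv (monom 1 q + [:0, inverse v:])"
      using Z by simp
    also have "\<dots> = [:inverse v:]"
      by (simp add: pderiv_add pderiv_monom of_nat_q pderiv_pCons)
    finally have "pderiv (R v) = [:inverse v:]" .
    moreover obtain a b where ab: "a \<in> A" "b \<in> A" "a \<noteq> b" "ell v a = ell v b"
      using assms by (auto simp: D_def inj_on_def)
    ultimately have "inverse v = (\<Prod>b\<in>A-{a}. ell v a - ell v b)"
      using poly_pderiv_prod_linear[OF finite_A ab(1), of "ell v"] by (simp add: R_def)
    also have "\<dots> = 0"
      using ab by (auto simp: prod_zero_iff)
    finally show False
      using mu_nonzero[OF v] by simp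
  qed
  then have "degree (R v) \<le> degree (h * pderiv (R v))"
    using dvd nz by (intro dvd_imp_degree_le) auto
  also have "\<dots> \<le> degree h + degree (pderiv (R v))"
    by (rule degree_mult_le)
  also have "\<dots> \<le> (card D - 1) + (card D - 1 - 1)"
  proof (rule add_mono)
    show "degree h \<le> card D - 1"
      unfolding h_def using degree_g[OF v] card_D_ge_2 by (intro degree_diff_le) auto
    show "degree (pderiv (R v)) \<le> card D - 1 - 1"
      using degree_pderiv_le[of "g v"] degree_g[OF v] by (simp add: pderiv_R)
  qed
  finally show False
    using degree_R[of v] card_D_le card_D_ge_2 by simp
qed

text \<open>
  The polynomials \<open>C a\<close> have degree below \<open>q + 1\<close> and agree on \<open>mu\<close>, so they do not depend on \<open>a\<close>. Reading
  off their orders shows that all occupied lines of a given direction carry equally many points.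
\<close>
definition C :: "'a \<Rightarrow> 'a poly" where
  "C a = (\<Prod>b\<in>A-{a}. [:a - b, - ((a - b) ^ q):])"

lemma poly_C:
  assumes "a \<in> A"
  shows "poly (C a) v = poly (pderiv (R v)) (ell v a)"
  unfolding R_def poly_pderiv_prod_linear[OF finite_A assms]
  by (simp add: C_def poly_prod ell_diff[symmetric]) (simp add: ell_def)

lemma C_eq:
  assumes "a \<in> A" "b \<in> A"
  shows "C a = C b"
proof (rule poly_eqI_degree)
  have "degree (C a) \<le> q - 1" if "a \<in> A" for a
  proof -
    have "degree (C a) \<le> (\<Sum>b\<in>A-{a}. 1)"
      unfolding C_def
      by (rule order_trans[OF degree_prod_sum_le], simp)
        (unfold comp_def, intro sum_mono order_trans[OF degree_pCons_le], simp)
    then show ?thesis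
      using that by (simp add: card_A)
  qed
  then show "degree (C a) < card mu" "degree (C b) < card mu"
    using assms by (force simp: card_mu)+
  fix v assume "v \<in> mu"
  then show "poly (C a) v = poly (C b) v"
    using assms by (cases "v \<in> D") (simp_all add: poly_C pderiv_R_D pderiv_R_not_D)
qed

section \<open>Numbers of points of \<open>A\<close> on the lines of a direction\<close>

definition m :: "'a \<Rightarrow> nat" where
  "m v = card {b \<in> A. ell v b = 0}"

text \<open>The factor of \<open>C a\<close> belonging to \<open>b\<close> vanishes at
  \<open>v\<close>, with order one, exactly when \<open>b\<close> lies on the line through
  \<open>a\<close> of direction \<open>v\<close>. The \<open>+ 1\<close> counts \<open>a\<close>
  itself.\<close>

lemma card_fiber_eq_order:
  assumes "a \<in> A"
  shows "card {b \<in> A. ell v b = ell v a} = order v (C a) + 1"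
proof -
  have "order v (C a) = (\<Sum>b\<in>A-{a}. order v [:a - b, - ((a - b) ^ q):])"
    unfolding C_def by (rule order_prod) auto
  also have "\<dots> = (\<Sum>b\<in>A-{a}. if ell v (a - b) = 0 then 1 else 0)"
    by (intro sum.cong refl) (subst order_linear, auto simp: ell_def)
  also have "\<dots> = card {b \<in> A-{a}. ell v b = ell v a}"
    by (subst sum.inter_filter[symmetric]) (auto simp: ell_diff intro!: arg_cong[where f = card])
  also have "{b \<in> A-{a}. ell v b = ell v a} = {b \<in> A. ell v b = ell v a} - {a}"
    by auto
  finally show ?thesis
    using assms card_gt_0_iff[of "{b \<in> A. ell v b = ell v a}"] by auto
qed

lemma card_fiber:
  assumes "a \<in> A"
  shows "card {b \<in> A. ell v b = ell v a} = m v"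
  using card_fiber_eq_order[OF assms, of v] card_fiber_eq_order[OF zero_in_A, of v]
    C_eq[OF assms zero_in_A]
  by (simp add: m_def)

lemma card_image_ell: "card (ell v ` A) * m v = q"
proof -
  have "q = (\<Sum>a\<in>A. 1)"
    by (simp add: card_A)
  also have "\<dots> = (\<Sum>y\<in>ell v ` A. \<Sum>x\<in>{x\<in>A. ell v x = y}. 1)"
    by (rule sum.image_gen) simp
  also have "\<dots> = (\<Sum>y\<in>ell v ` A. m v)"
    by (intro sum.cong refl) (auto simp: card_fiber)
  finally show ?thesis
    by simp
qed

lemma m_prime_power: "\<exists>e\<le>n. m v = p ^ e"
proof -
  have "m v dvd p ^ n"
    using card_image_ell[of v] by (metis dvd_triv_right q_eq)
  then show ?thesis
    by (simp add: divides_primepow_nat[OF prime_p])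
qed

lemma m_ge_p:
  assumes "v \<in> D"
  shows "m v \<ge> p"
proof -
  obtain e where e: "m v = p ^ e"
    using m_prime_power by blast
  have "\<not> card (ell v ` A) = card A"
    using assms by (auto simp: D_def inj_on_iff_eq_card)
  then have "m v \<noteq> 1"
    using card_image_ell[of v] card_A by auto
  then have "e \<noteq> 0"
    using e by (metis power_0)
  then show ?thesis
    using e p_gt_1 by (simp add: self_le_power)
qed

text \<open>The lines through \<open>0\<close> partition \<open>A - {0}\<close>, and those that meet
  it have directions in \<open>D\<close> because \<open>0 \<in> A\<close>.\<close>

lemma sum_m: "(\<Sum>v\<in>D. m v - 1) = q - 1"
proof -
  have "A - {0} = (\<Union>v\<in>D. {b \<in> A - {0}. ell v b = 0})"
  proof -
    have "\<exists>v\<in>D. ell v b = 0" if "b \<in> A - {0}" for b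
    proof (rule bexI)
      show "ell (b / b ^ q) b = 0"
        using that by (simp add: ell_def)
      show "b / b ^ q \<in> D"
        unfolding D_iff using that zero_in_A by (intro bexI[of _ b] bexI[of _ 0]) auto
    qed
    then show ?thesis
      by blast
  qed
  moreover have "q - 1 = card (A - {0})"
    using zero_in_A by (simp add: card_A)
  ultimately have "q - 1 = card (\<Union>v\<in>D. {b \<in> A - {0}. ell v b = 0})"
    by presburger
  also have "\<dots> = (\<Sum>v\<in>D. card {b \<in> A - {0}. ell v b = 0})"
    by (rule card_UN_disjoint) (auto simp: ell_eq_0_iff)
  also have "\<dots> = (\<Sum>v\<in>D. m v - 1)"
  proof (intro sum.cong refl)
    fix v
    have "{b \<in> A - {0}. ell v b = 0} = {b \<in> A. ell v b = 0} - {0}"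
      by auto
    then show "card {b \<in> A - {0}. ell v b = 0} = m v - 1"
      using zero_in_A by (simp add: m_def)
  qed
  finally show ?thesis
    by simp
qed

section \<open>The smallest multiplicity and additive closure of \<open>A\<close>\<close>

definition s :: nat where
  "s = Min (m ` D)"

lemma D_nonempty: "D \<noteq> {}"
  using card_D_ge_2 by auto

lemma s_le: "v \<in> D \<Longrightarrow> s \<le> m v"
  by (simp add: s_def)

lemma s_attained: "\<exists>v\<in>D. m v = s"
proof -
  have "s \<in> m ` D"
    unfolding s_def using D_nonempty by (intro Min_in) auto
  then show ?thesis
    by auto
qed

lemma s_ge_p: "s \<ge> p"
  using s_attained m_ge_p by metis

lemma card_D_mult_le: "card D * (s - 1) \<le> q - 1"
proof -
  have "card D * (s - 1) = (\<Sum>v\<in>D. s - 1)"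
    by simp
  also have "\<dots> \<le> (\<Sum>v\<in>D. m v - 1)"
    by (intro sum_mono diff_le_mono s_le)
  finally show ?thesis
    unfolding sum_m .
qed

lemma s_exponent: obtains e where "s = p ^ e" "e > 0" "e < n"
proof -
  obtain e where e: "e \<le> n" "s = p ^ e"
    using s_attained m_prime_power by metis
  have "2 * (s - 1) \<le> q - 1"
    using card_D_mult_le card_D_ge_2 by (meson le_trans mult_le_mono1)
  then have "s < q"
    using s_ge_p p_ge_3 by simp
  then have "e < n"
    using e p_gt_1 q_eq by (metis nat_less_le)
  moreover have "e \<noteq> 0"
    using e s_ge_p p_gt_1 by (intro notI) simp
  ultimately show ?thesis
    using e that by simp
qed

lemma m_eq_s_or_ge:
  assumes "v \<in> D"
  shows "m v = s \<or> p * s \<le> m v"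
proof -
  obtain e where e: "s = p ^ e"
    by (rule s_exponent)
  obtain f where f: "m v = p ^ f"
    using m_prime_power by blast
  have "e \<le> f"
    using s_le[OF assms] p_gt_1 unfolding e f by (metis power_increasing_iff)
  then consider "e = f" | "Suc e \<le> f"
    by linarith
  then show ?thesis
  proof cases
    case 2
    then have "p ^ Suc e \<le> p ^ f"
      using p_gt_1 by (intro power_increasing) auto
    then show ?thesis
      using e f by simp
  qed (simp add: e f)
qed

text \<open>The squarefree part of \<open>R v\<close>: one linear factor for each occupied line of
  direction \<open>v\<close>.\<close>

definition P :: "'a \<Rightarrow> 'a poly" where
  "P v = (\<Prod>z\<in>ell v ` A. [:- z, 1:])"

lemma R_eq_P_power: "R v = P v ^ m v"
proof -
  have "R v = (\<Prod>y\<in>ell v ` A. \<Prod>x\<in>{x\<in>A. ell v x = y}. [:- ell v x, 1:])"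
    unfolding R_def by (rule prod.image_gen) simp
  also have "\<dots> = (\<Prod>y\<in>ell v ` A. [:- y, 1:] ^ m v)"
    by (intro prod.cong refl) (auto simp: card_fiber)
  finally show ?thesis
    by (simp add: P_def prod_power_distrib)
qed

lemma poly_P_eq_0_iff: "poly (P v) z = 0 \<longleftrightarrow> z \<in> ell v ` A"
  by (auto simp: P_def poly_prod prod_zero_iff)

lemma degree_P: "degree (P v) * m v = q"
  using degree_prod_linear[of "ell v ` A" "\<lambda>z. z"] card_image_ell[of v] by (simp add: P_def)

text \<open>
  The polynomial \<open>P v = X ^ Q + h\<close> divides \<open>X / v - h ^ s\<close>. Counting the points of \<open>A\<close> on the lines
  through \<open>0\<close> bounds the degree of \<open>h\<close> so well that a comparison of derivatives forces the cofactor
  to be constant.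
\<close>
lemma minimal_direction:
  assumes "v \<in> D" "m v = s"
  obtains h c where "P v = monom 1 (degree (P v)) + h" "c \<noteq> 0"
    "[:0, inverse v:] - h ^ s = smult c (P v)" "degree (P v) < card D"
proof -
  obtain e where e: "s = p ^ e" "e > 0" "e < n"
    using s_exponent .
  have v: "v \<in> mu"
    using assms D_subset by auto
  have s3: "s \<ge> 3"
    using s_ge_p p_ge_3 by simp
  define Q where "Q = degree (P v)"
  have Qs: "Q * s = q"
    using degree_P[of v] assms by (simp add: Q_def)
  have "Q * s = p ^ (n - e) * s"
    using e Qs q_eq by (simp flip: power_add)
  then have Q: "Q = p ^ (n - e)"
    using s3 by simp
  have Q3: "Q \<ge> 3"
    using p_ge_3 p_gt_1 e self_le_power[of p "n - e"] unfolding Q by linarith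
  define h where "h = P v - monom 1 Q"
  have Ph: "P v = monom 1 Q + h"
    by (simp add: h_def)
  \<comment> \<open>As \<open>s\<close> is a power of \<open>p\<close>, Frobenius turns
    \<open>g v\<close> into an exact \<open>s\<close>-th power, which divides the bound on its
    degree by \<open>s\<close>.\<close>
  have "h ^ s = P v ^ s - monom 1 Q ^ s"
    unfolding h_def e(1) by (rule poly_diff_power_p)
  also have "P v ^ s = R v"
    by (simp only: R_eq_P_power assms(2))
  also have "monom 1 Q ^ s = (monom 1 q :: 'a poly)"
    by (simp only: monom_power power_one Qs)
  finally have hs: "h ^ s = g v"
    by (simp only: g_def)
  have "degree h * s = degree (h ^ s)"
    by (cases "h = 0") (use s3 in \<open>simp_all add: degree_power_eq power_0_left\<close>)
  then have "degree h * s = degree (g v)"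
    by (simp only: hs)
  then have deg_h: "degree h * s + 1 \<le> card D"
    using degree_g[OF v] card_D_ge_2 by linarith
  \<comment> \<open>With \<open>k = degree h\<close>, the inequality
    \<open>(k * s + 1) * (s - 1) \<le> Q * s - 1\<close> rearranges to
    \<open>(k * (s - 1) + 1) * s \<le> Q * s\<close>.\<close>
  have "(degree h * s + 1) * (s - 1) \<le> Q * s - 1"
    unfolding Qs by (rule order_trans[OF mult_le_mono1[OF deg_h] card_D_mult_le])
  moreover obtain t where t: "s = Suc t"
    using s3 by (cases s) auto
  moreover have "Q * Suc t \<ge> 1"
    using Q3 by simp
  ultimately have "(degree h * t + 1) * Suc t \<le> Q * Suc t"
    by (simp add: algebra_simps)
  then have kQ: "degree h * (s - 1) + 1 \<le> Q"
    unfolding t by (metis mult_le_cancel2 zero_less_Suc diff_Suc_1)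
  have ks: "degree h * s = degree h * (s - 1) + degree h"
    by (simp add: t)
  have k2: "degree h * 2 \<le> degree h * (s - 1)"
    using s3 by (intro mult_le_mono2) simp
  define u where "u = [:0, inverse v:] - h ^ s"
  have "P v dvd monom 1 q + [:0, inverse v:]"
    unfolding P_def by (rule prod_linear_dvd) (use ell_power_q[OF v] in \<open>auto simp: poly_monom\<close>)
  also have "monom 1 q + [:0, inverse v:] = P v ^ s + u"
    using R_eq_P_power[of v] assms by (simp add: u_def hs g_def)
  finally have "P v dvd u"
    using s3 by (subst (asm) dvd_add_right_iff) (auto intro: dvd_power)
  then obtain T where T: "u = P v * T"
    by (elim dvdE)
  have "pderiv (h ^ s) = 0"
    using of_nat_power_p[OF e(2)] e(1) by (simp add: pderiv_power)
  then have du: "pderiv u = [:inverse v:]"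
    by (simp add: u_def pderiv_diff pderiv_pCons)
  then have "u \<noteq> 0"
    using mu_nonzero[OF v] by auto
  then have T0: "T \<noteq> 0"
    using T by auto
  have "degree u = Q + degree T"
    using \<open>u \<noteq> 0\<close> T by (simp add: degree_mult_eq Q_def)
  moreover have "degree u \<le> max 1 (degree h * s)"
    unfolding u_def by (rule degree_diff_le) (auto intro: order_trans[OF degree_power_le])
  ultimately have QT: "Q + degree T \<le> degree h * s"
    using Q3 by linarith
  \<comment> \<open>\<open>QT\<close> and \<open>kQ\<close> give \<open>degree T < degree h\<close>,
    so the sum of the degrees is below \<open>2 * degree h\<close>, which is at most
    \<open>degree h * (s - 1) < Q\<close> because \<open>s \<ge> 3\<close>.\<close>
  have hT: "degree (h * T) < Q"
    using degree_mult_le[of h T] QT kQ k2 ks by linarith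
  have "of_nat Q = (0 :: 'a)"
    unfolding Q using e(3) by (intro of_nat_power_p) simp
  then have "pderiv (monom 1 Q :: 'a poly) = 0"
    by (simp only: pderiv_monom mult_zero_left monom_eq_0)
  then have "pderiv u = monom 1 Q * pderiv T + pderiv (h * T)"
    by (simp only: T Ph distrib_right pderiv_add pderiv_mult[of "monom 1 Q"] mult_zero_right add_0_right)
  then have eq: "monom 1 Q * pderiv T = [:inverse v:] - pderiv (h * T)"
    using du by (simp add: algebra_simps)
  \<comment> \<open>In \<open>eq\<close> the right side has degree below \<open>Q\<close>, so the
    multiple of \<open>X ^ Q\<close> on the left must vanish. Then \<open>T\<close> divides a
    nonzero constant.\<close>
  have "pderiv T = 0"
  proof (rule ccontr)
    assume "pderiv T \<noteq> 0"
    then have "Q \<le> degree (monom 1 Q * pderiv T)"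
      by (simp add: degree_mult_eq degree_monom_eq)
    also have "\<dots> \<le> degree (h * T)"
      unfolding eq using degree_pderiv_le[of "h * T"] by (intro degree_diff_le) auto
    finally show False
      using hT by simp
  qed
  then have "T * pderiv h = [:inverse v:]"
    using eq by (simp add: pderiv_mult)
  moreover from this have "pderiv h \<noteq> 0"
    using mu_nonzero[OF v] by auto
  ultimately have "degree T + degree (pderiv h) = 0"
    using degree_mult_eq[OF T0, of "pderiv h"] by simp
  then have "degree T = 0"
    by simp
  then obtain c where c: "T = [:c:]"
    by (metis degree_eq_zeroE)
  show ?thesis
  proof (rule that)
    show "P v = monom 1 (degree (P v)) + h"
      using Ph Q_def by simp
    show "c \<noteq> 0"
      using c T0 by simp
    show "[:0, inverse v:] - h ^ s = smult c (P v)"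
      using T by (simp add: u_def c)
    show "degree (P v) < card D"
      using QT deg_h unfolding Q_def by linarith
  qed
qed

lemma pcompose_power: "pcompose (f ^ k) r = pcompose f r ^ k" for f r :: "'a poly"
  by (induction k) (simp_all add: pcompose_1 pcompose_mult)

text \<open>
  For fixed \<open>y\<close> the additivity defect \<open>E\<close> of \<open>h\<close> satisfies \<open>c * E = - E ^ s\<close> as a polynomial in \<open>X\<close>, hence
  it is constant.
\<close>
lemma poly_P_add:
  assumes "v \<in> D" "m v = s"
  shows "poly (P v) (x + y) = poly (P v) x + poly (P v) y"
proof -
  obtain e where e: "s = p ^ e" "e > 0" "e < n"
    using s_exponent .
  have s2: "s \<ge> 2"
    using s_ge_p p_ge_3 by simp
  obtain h c where h: "P v = monom 1 (degree (P v)) + h" "c \<noteq> 0"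
    "[:0, inverse v:] - h ^ s = smult c (P v)"
    using minimal_direction[OF assms] .
  have "degree (P v) * p ^ e = p ^ (n - e) * p ^ e"
    using degree_P[of v] assms e q_eq by (simp flip: power_add)
  then have Q: "degree (P v) = p ^ (n - e)"
    using p_gt_1 by simp
  define E where "E f = pcompose f [:y, 1:] - f - [:poly f y:]" for f
  have E_diff: "E (f - f') = E f - E f'" for f f'
    by (simp add: E_def pcompose_diff)
  have E_add: "E (f + f') = E f + E f'" for f f'
    by (simp add: E_def pcompose_add)
  have E_smult: "E (smult a f) = smult a (E f)" for a f
    by (simp add: E_def pcompose_smult smult_diff_right)
  have E_power: "E (f ^ (p ^ k)) = E f ^ (p ^ k)" for f k
    by (simp add: E_def poly_diff_power_p pcompose_power flip: poly_const_pow)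
  have E_linear: "E [:0, a:] = 0" for a
    by (simp add: E_def pcompose_pCons)
  have "E (monom 1 (degree (P v))) = 0"
    using E_power[of "[:0, 1:]" "n - e"] E_linear[of 1] p_gt_1
    by (simp add: Q monom_altdef)
  then have "E (P v) = E h"
    using arg_cong[OF h(1), of E] by (simp add: E_add)
  then have "smult c (E h) = - (E h ^ s)"
    using arg_cong[OF h(3), of E] E_power[of h e]
    by (simp add: E_diff E_smult E_linear flip: e(1))
  then have "degree (E h) = degree (E h ^ s)"
    using h(2) by (metis degree_minus degree_smult_eq)
  also have "\<dots> = s * degree (E h)"
    using s2 by (cases "E h = 0") (simp_all add: degree_power_eq power_0_left)
  finally have "1 * degree (E h) = s * degree (E h)"
    by simp
  then have "degree (E h) = 0"
    unfolding mult_cancel2 using s2 by auto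
  then obtain b where b: "E h = [:b:]"
    by (metis degree_eq_zeroE)
  \<comment> \<open>The constant \<open>E (P v)\<close> is evaluated at \<open>0\<close>, where it
    equals \<open>- poly (P v) 0\<close>.\<close>
  have "poly (P v) 0 = 0"
    using zero_in_A ell_0 by (force simp: poly_P_eq_0_iff)
  then have "poly (E (P v)) 0 = 0"
    by (simp add: E_def poly_pcompose)
  then have "E (P v) = 0"
    unfolding \<open>E (P v) = E h\<close> b by simp
  then have "poly (E (P v)) x = 0"
    by simp
  then show ?thesis
    by (simp add: E_def poly_pcompose algebra_simps)
qed

lemma ell_image_add:
  assumes "v \<in> D" "m v = s" "x \<in> ell v ` A" "y \<in> ell v ` A"
  shows "x + y \<in> ell v ` A"
  using assms poly_P_add[OF assms(1,2), of x y] by (simp flip: poly_P_eq_0_iff)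

text \<open>Off \<open>D\<close>, \<open>R v\<close> is \<open>X ^ q + X / v\<close>, which vanishes
  at every value of \<open>ell v\<close>; hence every line of direction \<open>v\<close> meets
  \<open>A\<close>.\<close>

lemma ell_surj:
  assumes "v \<in> mu" "v \<notin> D"
  shows "ell v z \<in> ell v ` A"
proof -
  have "poly (R v) (ell v z) = 0"
    using ell_power_q[OF assms(1), of z] by (simp add: R_eq_if_not_D[OF assms] poly_monom)
  then show ?thesis
    by (auto simp: R_def poly_prod prod_zero_iff)
qed

text \<open>
  A point \<open>z = a + b\<close> outside \<open>A\<close> would see one point of \<open>A\<close> in each direction outside \<open>D\<close> and \<open>s\<close> points
  in each direction with \<open>m v = s\<close>. The other directions in \<open>D\<close> carry so many points each that there
  are too few of them for the total to stay below \<open>q\<close>.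
\<close>
lemma add_closed:
  assumes "a \<in> A" "b \<in> A"
  shows "a + b \<in> A"
proof (rule ccontr)
  define z where "z = a + b"
  assume "a + b \<notin> A"
  then have z: "z \<notin> A"
    by (simp add: z_def)
  define F where "F v = {c \<in> A. ell v c = ell v z}" for v
  define Ds where "Ds = {v \<in> D. m v = s}"
  obtain v0 where v0: "v0 \<in> D" "m v0 = s"
    using s_attained by blast
  define Q where "Q = degree (P v0)"
  have Qs: "Q * s = q"
    using degree_P[of v0] v0 by (simp add: Q_def)
  have QN: "Q < card D"
    using minimal_direction[OF v0] unfolding Q_def by metis
  have s3: "s \<ge> 3"
    using s_ge_p p_ge_3 by simp
  have F_Ds: "card (F v) = s" if "v \<in> Ds" for v
  proof -
    have "ell v z \<in> ell v ` A"
      unfolding z_def ell_add using that assms by (intro ell_image_add) (auto simp: Ds_def)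
    then obtain c where "c \<in> A" "ell v z = ell v c"
      by auto
    then show ?thesis
      using that card_fiber[of c v] by (simp add: F_def Ds_def)
  qed
  have F_not_D: "card (F v) \<ge> 1" if "v \<in> mu - D" for v
  proof -
    have "F v \<noteq> {}"
      using ell_surj[of v z] that by (force simp: F_def)
    then show ?thesis
      by (simp add: Suc_le_eq card_gt_0_iff)
  qed
  \<comment> \<open>Since \<open>z \<notin> A\<close>, the vector \<open>c - z\<close> is nonzero
    and has a single direction.\<close>
  have disj: "F v \<inter> F w = {}" if "v \<noteq> w" for v w
  proof -
    have "u = (c - z) / (c - z) ^ q" if "c \<in> F u" for c u
      using that z ell_eq_0_iff[of "c - z" u] by (auto simp: F_def ell_diff)
    then show ?thesis
      using that by blast
  qed
  have Ds: "Ds \<subseteq> D" "Ds \<inter> (mu - D) = {}"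
    by (auto simp: Ds_def)
  have "(q + 1 - card D) + card Ds * s = (\<Sum>v\<in>mu-D. 1) + (\<Sum>v\<in>Ds. s)"
    using D_subset card_mu by (simp add: card_Diff_subset)
  also have "\<dots> \<le> (\<Sum>v\<in>mu-D. card (F v)) + (\<Sum>v\<in>Ds. card (F v))"
    using F_not_D F_Ds by (intro add_mono sum_mono) auto
  also have "\<dots> = (\<Sum>v\<in>(mu-D) \<union> Ds. card (F v))"
    using Ds by (subst sum.union_disjoint) auto
  also have "\<dots> = card (\<Union>v\<in>(mu-D) \<union> Ds. F v)"
    using disj by (intro card_UN_disjoint[symmetric]) (auto simp: F_def)
  also have "\<dots> \<le> card A"
    by (intro card_mono) (auto simp: F_def)
  finally have le1: "1 + card Ds * s \<le> card D"
    using card_D_le card_A by linarith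
  define Db where "Db = D - Ds"
  have D_split: "card D = card Ds + card Db"
    unfolding Db_def using Ds card_mono[of D Ds] by (simp add: card_Diff_subset)
  have "card Db * (p * s - 1) = (\<Sum>v\<in>Db. p * s - 1)"
    by simp
  also have "\<dots> \<le> (\<Sum>v\<in>Db. m v - 1)"
    using m_eq_s_or_ge by (intro sum_mono diff_le_mono) (auto simp: Db_def Ds_def)
  also have "\<dots> \<le> (\<Sum>v\<in>D. m v - 1)"
    by (intro sum_mono2) (auto simp: Db_def)
  finally have le2: "card Db * (p * s - 1) \<le> q - 1"
    by (simp only: sum_m)
  \<comment> \<open>By \<open>le1\<close>, \<open>card D * (s - 1) < card Db * s\<close>, while
    \<open>card D > Q\<close>. By \<open>le2\<close> and \<open>2 * s \<le> p * s - 1\<close>,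
    \<open>2 * (card Db * s) < Q * s\<close>. Together \<open>2 * (Q + 1) * (s - 1) < Q * s\<close>,
    which fails for \<open>s \<ge> 3\<close>.\<close>
  obtain t where t: "s = Suc (Suc t)" "t \<ge> 1"
    using s3 by (cases s; cases "s - 1") auto
  have "card Ds * (s - 1) + 1 \<le> card Db"
    using le1 D_split t(1) by (simp add: algebra_simps)
  then have "(Q + 1) * Suc t < card Db * s"
  proof -
    assume *: "card Ds * (s - 1) + 1 \<le> card Db"
    have "(Q + 1) * Suc t \<le> card D * Suc t"
      using QN by (intro mult_le_mono1) simp
    also have "\<dots> < card Db * s"
      using * by (simp add: D_split t(1) algebra_simps)
    finally show ?thesis .
  qed
  moreover have "2 * s \<le> p * s - 1"
    using p_ge_3 s3 mult_le_mono1[of 3 p s] by linarith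
  ultimately have "(Q + 1) * Suc t * (2 * s) < card Db * s * (p * s - 1)"
    by (rule mult_less_le_imp_less) (use s3 in simp_all)
  also have "\<dots> \<le> (q - 1) * s"
    using mult_le_mono1[OF le2, of s] by (simp add: mult_ac)
  also have "\<dots> \<le> Q * s * s"
    unfolding Qs by (rule mult_le_mono1) simp
  finally have "((Q + 1) * Suc t * 2) * s < (Q * s) * s"
    by (simp only: mult.assoc)
  then have "(Q + 1) * Suc t * 2 < Q * s"
    by (rule mult_less_cancel2[THEN iffD1, THEN conjunct2])
  then show False
    using t by (simp add: algebra_simps)
qed

end

context quadratic_field
begin

theorem add_closed_if_few_directions:
  assumes "p \<ge> 3" "0 \<in> A" "2 * card D \<le> q + 1" "a \<in> A" "b \<in> A"
  shows "a + b \<in> A"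
proof (cases "card D \<ge> 2")
  case True
  then interpret few_directions p n q A
    using assms by unfold_locales auto
  show ?thesis
    using assms by (intro add_closed)
next
  \<comment> \<open>With at most one direction, \<open>A\<close> lies on one line through
    \<open>0\<close> and fills it by cardinality.\<close>
  case False
  have "card (A - {0}) > 0"
    using q_gt_1 assms card_A by simp
  then obtain c where c: "c \<in> A" "c \<noteq> 0"
    by (auto simp: card_gt_0_iff)
  define v where "v = c / c ^ q"
  have "x / x ^ q \<in> D" if "x \<in> A" "x \<noteq> 0" for x
    unfolding D_iff using that assms(2) by (intro bexI[of _ x] bexI[of _ 0]) auto
  then have "x / x ^ q = v" if "x \<in> A" "x \<noteq> 0" for x
    using that c False card_le_Suc0_iff_eq[of D] by (auto simp: v_def)
  then have "ell v x = 0" if "x \<in> A" for x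
    using that ell_eq_0_iff[of x v] by (cases "x = 0") auto
  then have "A \<subseteq> {x. ell v x = 0}"
    by auto
  moreover have "card {x. ell v x = 0} \<le> card A"
  proof -
    let ?f = "[:0, 1:] - monom v q"
    have "coeff ?f 1 = 1"
      using q_gt_1 by simp
    then have "?f \<noteq> 0"
      by (metis coeff_0 zero_neq_one)
    moreover have "degree ?f \<le> q"
      using q_gt_1 by (intro degree_diff_le degree_monom_le) simp
    moreover have "{x. ell v x = 0} = {x. poly ?f x = 0}"
      by (simp add: ell_def poly_monom)
    ultimately show ?thesis
      using card_poly_roots_bound[of ?f] card_A by simp
  qed
  ultimately have "A = {x. ell v x = 0}"
    by (intro card_seteq) auto
  then show ?thesis
    using assms by (simp add: ell_add)
qed

end

subsection \<open>Digit sums and orders of vanishing\<close>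

definition digit_sum :: "nat \<Rightarrow> nat \<Rightarrow> nat \<Rightarrow> nat" where
  "digit_sum p m x = (\<Sum>l<m. x div p ^ l mod p)"

lemma digit_sum_Suc: "digit_sum p (Suc m) x = x mod p + digit_sum p m (x div p)"
  by (simp add: digit_sum_def sum.lessThan_Suc_shift div_mult2_eq del: sum.lessThan_Suc)

lemma digit_sum_append:
  assumes "y < p ^ k"
  shows "digit_sum p (k + m) (p ^ k * x + y) = digit_sum p k y + digit_sum p m x"
  using assms
proof (induction k arbitrary: y)
  case 0
  then show ?case
    by (simp add: digit_sum_def)
next
  case (Suc k)
  then have "p > 0"
    by (cases p) auto
  then have "(p ^ Suc k * x + y) div p = p ^ k * x + y div p" "(p ^ Suc k * x + y) mod p = y mod p"
    by (simp_all add: mult.assoc)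
  moreover have "y div p < p ^ k"
    using Suc.prems by (simp add: less_mult_imp_div_less mult.commute)
  ultimately show ?case
    using Suc.IH by (simp add: digit_sum_Suc)
qed

text \<open>Subtraction from \<open>p ^ k - 1\<close> replaces each digit \<open>c\<close> by
  \<open>p - 1 - c\<close>, without borrows.\<close>

lemma digit_sum_complement:
  assumes "y < p ^ k"
  shows "digit_sum p k y + digit_sum p k (p ^ k - 1 - y) = k * (p - 1)"
  using assms
proof (induction k arbitrary: y)
  case 0
  then show ?case
    by (simp add: digit_sum_def)
next
  case (Suc k)
  then have p: "p > 0"
    by (cases p) auto
  have y: "y div p < p ^ k"
    using Suc.prems by (simp add: less_mult_imp_div_less mult.commute)
  define w where "w = p ^ k - 1 - y div p"
  define z where "z = p - 1 - y mod p"
  have z: "z < p"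
    using p by (simp add: z_def)
  have "p ^ k = w + y div p + 1"
    using y by (simp add: w_def)
  then have "p ^ Suc k = p * w + p * (y div p) + p"
    by (simp add: distrib_left)
  moreover have "p = z + y mod p + 1"
    using p mod_less_divisor[OF p, of y] by (simp add: z_def)
  ultimately have "p ^ Suc k - 1 - y = p * w + z"
    using mult_div_mod_eq[of p y] by linarith
  then have "digit_sum p (Suc k) (p ^ Suc k - 1 - y) = z + digit_sum p k w"
    using z by (simp only: digit_sum_Suc) simp
  moreover have "y mod p + z = p - 1"
    using mod_less_divisor[OF p, of y] by (simp add: z_def)
  ultimately show ?case
    using Suc.IH[OF y] by (simp add: digit_sum_Suc w_def)
qed

lemma digit_expansion: "(\<Sum>l<m. (x div p ^ l mod p) * p ^ l) = x mod p ^ m" for x p :: nat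
proof (induction m)
  case (Suc m)
  have "x mod (p ^ m * p) = p ^ m * (x div p ^ m mod p) + x mod p ^ m"
    by (rule mod_mult2_eq)
  then show ?case
    using Suc.IH by (simp add: mult.commute)
qed simp

text \<open>The usual multiplicity criterion survives up to the characteristic: raising the order
  from \<open>M\<close> to \<open>M + 1\<close> divides by \<open>M\<close>, still nonzero in the
  field.\<close>

lemma linear_power_dvd_if_derivatives_vanish:
  fixes f :: "'a::field poly"
  assumes "M \<le> CHAR('a)" "\<And>k. k < M \<Longrightarrow> poly ((pderiv ^^ k) f) x = 0"
  shows "[:-x, 1:] ^ M dvd f"
  using assms
proof (induction M arbitrary: f)
  case (Suc M)
  let ?t = "[:-x, 1:]"
  have "?t ^ M dvd pderiv f"
    using Suc.prems(1) Suc.prems(2)[of "Suc _"] by (intro Suc.IH) (auto simp: funpow_Suc_right simp del: funpow.simps)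
  moreover have "?t ^ M dvd f"
    using Suc.prems by (intro Suc.IH) auto
  then obtain w where w: "f = ?t ^ M * w"
    by (elim dvdE)
  have "?t dvd w"
  proof (cases M)
    case 0
    then show ?thesis
      using Suc.prems(2)[of 0] w by (simp add: poly_eq_0_iff_dvd)
  next
    case (Suc L)
    have "pderiv f = ?t ^ M * pderiv w + smult (of_nat M) (?t ^ L * w)"
      unfolding w Suc pderiv_mult pderiv_power_Suc by (simp add: pderiv_pCons mult.commute)
    then have "?t ^ M dvd smult (of_nat M) (?t ^ L * w)"
      using \<open>?t ^ M dvd pderiv f\<close> by (metis dvd_add_right_iff dvd_triv_left)
    moreover have "of_nat M \<noteq> (0 :: 'a)"
      unfolding of_nat_eq_0_iff_char_dvd using Suc.prems(1) Suc by (auto dest: dvd_imp_le)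
    ultimately have "?t ^ L * ?t dvd ?t ^ L * w"
      using Suc by (simp add: dvd_smult_iff mult.commute)
    then show ?thesis
      by (metis dvd_mult_cancel_left power_eq_0_iff pCons_eq_0_iff zero_neq_one)
  qed
  then show ?case
    unfolding w power_Suc2 by (intro mult_dvd_mono) auto
qed simp

text \<open>Differentiation lowers a positive order \<open>k\<close> by exactly one unless
  \<open>k\<close> is zero in the field.\<close>

lemma CHAR_dvd_order_if_pderiv_eq_0:
  fixes f :: "'a::field poly"
  assumes "pderiv f = 0" "f \<noteq> 0"
  shows "CHAR('a) dvd order x f"
proof (cases "order x f")
  case (Suc k)
  obtain w where w: "f = [:-x, 1:] ^ order x f * w" "\<not> [:-x, 1:] dvd w"
    using order_decomp[OF assms(2)] by blast
  have "[:-x, 1:] ^ k * ([:-x, 1:] * pderiv w + smult (of_nat (Suc k)) w) = pderiv f"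
    unfolding arg_cong[OF w(1), of pderiv] Suc pderiv_mult pderiv_power_Suc
    by (simp add: pderiv_pCons algebra_simps)
  then have "[:-x, 1:] * pderiv w + smult (of_nat (Suc k)) w = 0"
    using assms(1) by (metis mult_eq_0_iff pCons_eq_0_iff power_eq_0_iff zero_neq_one)
  then have "poly ([:-x, 1:] * pderiv w + smult (of_nat (Suc k)) w) x = 0"
    by simp
  then have "of_nat (Suc k) * poly w x = 0"
    by simp
  then show ?thesis
    using w(2) unfolding Suc of_nat_eq_0_iff_char_dvd[symmetric, where 'a = 'a]
    by (simp add: poly_eq_0_iff_dvd)
qed auto

text \<open>The term of least order cannot be cancelled by the others.\<close>

lemma sum_nonzero_if_orders_distinct:
  fixes f :: "'i \<Rightarrow> 'a::idom poly"
  assumes "finite I" "inj_on (\<lambda>i. order x (f i)) {i\<in>I. f i \<noteq> 0}" "\<exists>i\<in>I. f i \<noteq> 0"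
  shows "(\<Sum>i\<in>I. f i) \<noteq> 0"
proof
  assume sum0: "(\<Sum>i\<in>I. f i) = 0"
  let ?J = "{i\<in>I. f i \<noteq> 0}"
  obtain k where k: "k \<in> ?J" "\<And>i. i \<in> ?J \<Longrightarrow> order x (f k) \<le> order x (f i)"
    using ex_min_if_finite[of "(\<lambda>i. order x (f i)) ` ?J"] assms by (force simp: not_less)
  have "[:-x, 1:] ^ Suc (order x (f k)) dvd f i" if "i \<in> I - {k}" for i
  proof (cases "f i = 0")
    case False
    then have "order x (f i) \<noteq> order x (f k)"
      using assms(2) k(1) that by (auto simp: inj_on_def)
    then show ?thesis
      using k(2)[of i] that False by (subst order_divides) auto
  qed simp
  then have "[:-x, 1:] ^ Suc (order x (f k)) dvd (\<Sum>i\<in>I - {k}. f i)"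
    by (intro dvd_sum)
  moreover have "f k = - (\<Sum>i\<in>I - {k}. f i)"
    using sum0 k(1) assms(1) by (simp add: sum.remove[of I k] add_eq_0_iff2)
  ultimately have "[:-x, 1:] ^ Suc (order x (f k)) dvd f k"
    by simp
  then show False
    using order_2[of "f k" x] k(1) by auto
qed

subsection \<open>Stepanov's method on a line over the prime field\<close>

locale shifted_line =
  fixes p n q d u :: nat and a :: "'a::{field, finite}" and T :: "'a set"
  assumes prime_p: "Factorial_Ring.prime p"
    and CHAR_p: "CHAR('a) = p"
    and n_pos: "n > 0"
    and q_eq: "q = p ^ n"
    and du: "d * u = q + 1"
    and d_ge_2: "d \<ge> 2"
    and four_n_le: "4 * n \<le> p"
    and conjugates: "\<And>l. 0 < l \<Longrightarrow> l < 2 * n \<Longrightarrow> a ^ (p ^ l) \<noteq> a"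
    and T: "\<And>j. j < p \<Longrightarrow> (of_nat j + a) ^ ((q - 1) * u) \<in> T"
begin

lemma p_gt_1: "p > 1"
  using prime_p by (rule prime_gt_1_nat)

lemma q_gt_1: "q > 1"
  using p_gt_1 n_pos unfolding q_eq by (metis one_less_power)

lemma add_power_p: "(x + y :: 'a) ^ (p ^ e) = x ^ (p ^ e) + y ^ (p ^ e)"
  by (rule freshmans_dream'[where n = e]) (simp_all add: CHAR_p prime_p)

lemma of_nat_power_p: "(of_nat j :: 'a) ^ (p ^ e) = of_nat j"
  using p_gt_1 by (induction j) (simp_all add: add_power_p)

section \<open>Polynomials of low degree that represent high powers on the prime field\<close>

definition E :: "nat \<Rightarrow> nat" where
  "E i = i * ((q - 1) * u)"

definition dig :: "nat \<Rightarrow> nat \<Rightarrow> nat" where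
  "dig i l = E i div p ^ l mod p"

definition lin :: "nat \<Rightarrow> 'a poly" where
  "lin l = [:a ^ (p ^ l), 1:]"

text \<open>On the prime field \<open>(x + a) ^ (p ^ l)\<close> equals the linear polynomial
  \<open>lin l\<close>. Expanding the exponent \<open>E i\<close> in base \<open>p\<close> thus
  replaces \<open>(x + a) ^ E i\<close> by a polynomial whose degree is only a digit sum.\<close>

definition G :: "nat \<Rightarrow> 'a poly" where
  "G i = (\<Prod>l<2*n. lin l ^ dig i l)"

text \<open>A common denominator of the logarithmic derivatives of all \<open>G i\<close>.\<close>

definition h :: "'a poly" where
  "h = (\<Prod>l<2*n. lin l)"

lemma poly_lin: "poly (lin l) (of_nat j) = (of_nat j + a) ^ (p ^ l)"
  by (simp add: lin_def add_power_p of_nat_power_p add.commute)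

lemma lin_nonzero [simp]: "lin l \<noteq> 0"
  by (simp add: lin_def)

lemma degree_lin [simp]: "degree (lin l) = 1"
  by (simp add: lin_def)

lemma pderiv_lin [simp]: "pderiv (lin l) = 1"
  by (simp add: lin_def pderiv_pCons)

lemma G_nonzero: "G i \<noteq> 0"
  by (simp add: G_def)

lemma E_less:
  assumes "i < d"
  shows "E i < p ^ (2 * n)"
proof -
  have "E i \<le> d * ((q - 1) * u)"
    unfolding E_def using assms by (intro mult_le_mono1) simp
  also have "\<dots> = (q - 1) * (q + 1)"
    using du by (metis mult.assoc mult.commute)
  also have "\<dots> < q * q"
    using q_gt_1 by (simp add: diff_mult_distrib)
  finally show ?thesis
    by (simp add: q_eq mult_2 power_add)
qed

lemma poly_G:
  assumes "i < d"
  shows "poly (G i) (of_nat j) = ((of_nat j + a) ^ ((q - 1) * u)) ^ i"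
proof -
  have "poly (G i) (of_nat j) = (\<Prod>l<2*n. (of_nat j + a) ^ (dig i l * p ^ l))"
    by (simp add: G_def poly_prod poly_lin mult.commute flip: power_mult)
  also have "\<dots> = (of_nat j + a) ^ (\<Sum>l<2*n. dig i l * p ^ l)"
    by (simp add: power_sum)
  also have "(\<Sum>l<2*n. dig i l * p ^ l) = E i"
    unfolding dig_def digit_expansion using E_less[OF assms] by simp
  finally show ?thesis
    by (simp add: E_def mult.commute flip: power_mult)
qed

text \<open>Otherwise \<open>a\<close> would lie in the prime field and be fixed by
  Frobenius.\<close>

lemma shift_nonzero: "of_nat j + a \<noteq> 0"
proof
  assume "of_nat j + a = 0"
  then have "a = - of_nat j"
    by (simp add: eq_neg_iff_add_eq_0 add.commute)
  moreover have "(- of_nat j :: 'a) ^ p = - of_nat j"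
    using minus_power_prime_CHAR[of p "of_nat j :: 'a"] CHAR_p prime_p of_nat_power_p[of j 1] by simp
  ultimately show False
    using conjugates[of 1] n_pos by simp
qed

lemma poly_h_nonzero: "poly h (of_nat j) \<noteq> 0"
  using shift_nonzero by (simp add: h_def poly_prod poly_lin prod_zero_iff)

lemma degree_h: "degree h = 2 * n"
  unfolding h_def by (subst degree_prod_sum_eq) auto

text \<open>With \<open>k = i * u \<ge> 1\<close>,
  \<open>E i = q * (k - 1) + (q - 1 - (k - 1))\<close>: the upper and lower \<open>n\<close> digits
  are complementary, which halves the trivial bound \<open>2 * n * (p - 1)\<close>.\<close>

lemma degree_G:
  assumes "i < d"
  shows "degree (G i) \<le> n * (p - 1)"
proof (cases "i = 0")
  case True
  then show ?thesis
    by (simp add: G_def dig_def E_def)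
next
  case False
  define k where "k = i * u"
  have u: "u > 0"
    using du by (cases u) auto
  have k: "1 \<le> k"
    using False u by (simp add: k_def Suc_le_eq)
  have "i * u < d * u"
    using assms u by simp
  then have kq: "k \<le> q"
    using du by (simp add: k_def)
  have "k * q = q * (k - 1) + q"
    using k by (cases k) auto
  then have "E i = q * (k - 1) + (q - k)"
    using kq by (simp add: E_def k_def diff_mult_distrib2 mult_ac)
  then have Ei: "E i = p ^ n * (k - 1) + (p ^ n - 1 - (k - 1))"
    using k by (simp add: q_eq)
  have "degree (G i) = digit_sum p (n + n) (E i)"
    unfolding G_def digit_sum_def dig_def
    by (subst degree_prod_sum_eq) (auto simp: degree_power_eq mult_2)
  also have "\<dots> = digit_sum p n (p ^ n - 1 - (k - 1)) + digit_sum p n (k - 1)"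
    unfolding Ei by (rule digit_sum_append) (use p_gt_1 in \<open>simp add: Suc_le_eq less_Suc_eq_le\<close>)
  also have "\<dots> = n * (p - 1)"
    using digit_sum_complement[of "k - 1" p n] k kq q_eq by (simp add: add.commute)
  finally show ?thesis
    by simp
qed

text \<open>Among the factors only \<open>lin 0\<close> vanishes at \<open>- a\<close>, because
  \<open>a\<close> differs from its other conjugates.\<close>

lemma order_G: "order (- a) (G i) = E i mod p"
proof -
  have "order (- a) (lin l ^ dig i l) = 0" if "l \<in> {..<2*n} - {0}" for l
    using conjugates[of l] that by (intro order_0I) (auto simp: lin_def)
  then have "order (- a) (G i) = order (- a) (lin 0 ^ dig i 0)"
    unfolding G_def using n_pos by (subst order_prod) (auto simp: sum.remove[of _ 0])
  also have "\<dots> = dig i 0"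
    using order_power_n_n[of "- a"] by (simp add: lin_def)
  finally show ?thesis
    by (simp add: dig_def)
qed

definition B :: nat where
  "B = p div d + 1"

lemma B_le_p: "B \<le> p"
proof -
  have "p div d < p"
    using p_gt_1 d_ge_2 by simp
  then show ?thesis
    by (simp add: B_def)
qed

text \<open>
  As \<open>d * u = 1\<close> and \<open>E i = - i * u\<close> modulo \<open>p\<close>, the congruence is equivalent to \<open>d * b - i = c * d\<close>, and
  the numbers \<open>d * b - i\<close> run through \<open>d * B > p\<close> consecutive integers.
\<close>
lemma residue_cover:
  assumes "c < p"
  shows "\<exists>i b. i < d \<and> b < B \<and> (b + E i) mod p = c"
proof -
  \<comment> \<open>These choices give \<open>d * b - i = w - (d - 1)\<close>, which is congruent to
    \<open>c * d\<close> modulo \<open>p\<close>.\<close>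
  define w where "w = (c * d + (d - 1)) mod p"
  define b where "b = w div d"
  define i where "i = d - 1 - w mod d"
  have d0: "d > 0"
    using d_ge_2 by simp
  have "w < p"
    using p_gt_1 by (simp add: w_def)
  then have b: "b < B"
    by (simp add: b_def B_def div_le_mono less_Suc_eq_le)
  have i: "i < d" "int i = int d - 1 - int (w mod d)"
    using d0 mod_less_divisor[OF d0, of w] by (auto simp: i_def)
  have "int w = int d * int b + int (w mod d)"
    by (simp add: b_def flip: of_nat_mult of_nat_add)
  then have eq: "int d * int b - int i - int c * int d = int w - (int c * int d + (int d - 1))"
    using i by simp
  have "int (c * d + (d - 1)) = int c * int d + (int d - 1)"
    using d0 by (simp add: of_nat_diff)
  then have "int w = (int c * int d + (int d - 1)) mod int p"
    by (simp only: w_def zmod_int)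
  then have "int p dvd int w - (int c * int d + (int d - 1))"
    by (metis mod_eq_dvd_iff mod_mod_trivial)
  then have "int p dvd int d * int b - int i - int c * int d"
    unfolding eq .
  then have "int p dvd int u * (int d * int b - int i - int c * int d)"
    by (rule dvd_mult)
  also have "int u * (int d * int b - int i - int c * int d)
      = int (d * u) * (int b - int c) - int i * int u"
    by (simp add: algebra_simps)
  also have "\<dots> = int b - int c + int (E i) + int q * (int b - int c - int i * int u)"
    unfolding du E_def using q_gt_1 by (simp add: algebra_simps of_nat_diff)
  finally have "int p dvd int b - int c + int (E i)"
    using n_pos unfolding q_eq
    by (metis dvd_add_left_iff dvd_mult2 dvd_power of_nat_dvd_iff)
  then have "int p dvd int (b + E i) - int c"
    by (simp add: algebra_simps)
  then have "int (b + E i) mod int p = int c mod int p"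
    by (simp add: mod_eq_dvd_iff)
  then have "(b + E i) mod p = c"
    using assms by (metis mod_less of_nat_eq_iff zmod_int)
  then show ?thesis
    using i b by blast
qed

text \<open>The logarithmic derivative of \<open>G i\<close> is the sum of the
  \<open>dig i l / lin l\<close>; multiplication by \<open>h\<close> clears the
  denominators.\<close>

lemma derivative_G: "\<exists>V. degree V \<le> 2 * n - 1 \<and> h * pderiv (G i) = G i * V"
proof (intro exI conjI)
  let ?V = "\<Sum>l<2*n. smult (of_nat (dig i l)) (\<Prod>k\<in>{..<2*n}-{l}. lin k)"
  show "degree ?V \<le> 2 * n - 1"
  proof (rule degree_sum_le)
    fix l assume "l \<in> {..<2*n}"
    then have "degree (\<Prod>k\<in>{..<2*n}-{l}. lin k) = 2 * n - 1"
      by (subst degree_prod_sum_eq) auto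
    then show "degree (smult (of_nat (dig i l)) (\<Prod>k\<in>{..<2*n}-{l}. lin k)) \<le> 2 * n - 1"
      using degree_smult_le by metis
  qed simp
  have lin_power: "lin l * pderiv (lin l ^ e) = smult (of_nat e) (lin l ^ e)" for l e
    by (cases e) (simp_all only: pderiv_power_Suc pderiv_lin, auto)
  have "h * ((\<Prod>k\<in>{..<2*n}-{l}. lin k ^ dig i k) * pderiv (lin l ^ dig i l))
      = G i * smult (of_nat (dig i l)) (\<Prod>k\<in>{..<2*n}-{l}. lin k)" if "l \<in> {..<2*n}" for l
  proof -
    let ?X = "\<Prod>k\<in>{..<2*n}-{l}. lin k ^ dig i k" and ?Y = "\<Prod>k\<in>{..<2*n}-{l}. lin k"
    have h: "h = lin l * ?Y" and G: "G i = lin l ^ dig i l * ?X"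
      unfolding h_def G_def using that by (simp_all add: prod.remove)
    have "h * (?X * pderiv (lin l ^ dig i l)) = (lin l * pderiv (lin l ^ dig i l)) * (?X * ?Y)"
      unfolding h by (simp only: mult_ac)
    also have "\<dots> = G i * smult (of_nat (dig i l)) ?Y"
      unfolding lin_power G by (simp only: mult_smult_left mult_smult_right mult_ac)
    finally show ?thesis .
  qed
  then show "h * pderiv (G i) = G i * ?V"
    unfolding G_def pderiv_prod sum_distrib_left by (intro sum.cong) (simp_all add: G_def)
qed

text \<open>Keeping the factor \<open>G i\<close> explicit lets its value on the prime field be
  replaced by a power of an element of \<open>T\<close>, while the cofactor grows by only
  \<open>2 * n - 1\<close> per derivative.\<close>

lemma higher_derivative_G:
  "\<exists>W. degree W \<le> b + k * (2 * n - 1) \<and> h ^ k * (pderiv ^^ k) ([:a, 1:] ^ b * G i) = G i * W"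
proof (induction k)
  case 0
  show ?case
    by (rule exI[of _ "[:a, 1:] ^ b"]) (simp add: degree_power_eq mult.commute)
next
  case (Suc k)
  let ?K = "(pderiv ^^ k) ([:a, 1:] ^ b * G i)"
  obtain W where W: "degree W \<le> b + k * (2 * n - 1)" "h ^ k * ?K = G i * W"
    using Suc.IH by blast
  obtain V where V: "degree V \<le> 2 * n - 1" "h * pderiv (G i) = G i * V"
    using derivative_G by blast
  \<comment> \<open>From \<open>h ^ Suc k * pderiv ?K = h * pderiv (h ^ k * ?K) - k * pderiv h * (h
    ^ k * ?K)\<close>.\<close>
  let ?W = "h * pderiv W + V * W - smult (of_nat k) (pderiv h * W)"
  show ?case
  proof (intro exI conjI)
    have deg1: "degree (h * pderiv W) \<le> degree W + (2 * n - 1)"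
    proof (cases "degree W = 0")
      case True
      then have "pderiv W = 0"
        by (metis degree_eq_zeroE pderiv_singleton)
      then show ?thesis
        by simp
    next
      case False
      then show ?thesis
        using degree_mult_le[of h "pderiv W"] degree_pderiv_le[of W] degree_h n_pos by linarith
    qed
    have deg2: "degree (V * W) \<le> degree W + (2 * n - 1)"
      using degree_mult_le[of V W] V(1) by linarith
    have deg3: "degree (smult (of_nat k) (pderiv h * W)) \<le> degree W + (2 * n - 1)"
      using degree_smult_le[of "of_nat k" "pderiv h * W"] degree_mult_le[of "pderiv h" W]
        degree_pderiv_le[of h] degree_h by linarith
    have "degree ?W \<le> degree W + (2 * n - 1)"
      by (intro degree_diff_le degree_add_le deg1 deg2 deg3)
    then show "degree ?W \<le> b + Suc k * (2 * n - 1)"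
      using W(1) by simp
    have hk: "h * pderiv (h ^ k) = smult (of_nat k) (h ^ k * pderiv h)"
      by (cases k) (simp_all only: pderiv_power_Suc, simp_all add: mult.assoc)
    have "h ^ Suc k * pderiv ?K = h * (pderiv (h ^ k * ?K) - ?K * pderiv (h ^ k))"
      by (simp add: pderiv_mult mult_ac)
    also have "\<dots> = h * pderiv (G i * W) - ?K * (h * pderiv (h ^ k))"
      unfolding W(2) by (simp add: algebra_simps)
    also have "\<dots> = G i * (h * pderiv W) + (h * pderiv (G i)) * W - smult (of_nat k) (pderiv h * (h ^ k * ?K))"
      unfolding hk by (simp add: pderiv_mult algebra_simps)
    also have "\<dots> = G i * ?W"
      unfolding W(2) V(2) by (simp add: algebra_simps)
    finally show "h ^ Suc k * (pderiv ^^ Suc k) ([:a, 1:] ^ b * G i) = G i * ?W"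
      by simp
  qed
qed

section \<open>Vanishing on the prime field and the auxiliary polynomial\<close>

lemma prime_subfield_roots_bound:
  fixes F :: "'a poly"
  assumes "F \<noteq> 0" "M \<le> p"
    and "\<And>j k. j < p \<Longrightarrow> k < M \<Longrightarrow> poly ((pderiv ^^ k) F) (of_nat j) = 0"
  shows "p * M \<le> degree F"
proof (cases "M = 0")
  case False
  have ord: "M \<le> order (of_nat j) F" if "j < p" for j
    using linear_power_dvd_if_derivatives_vanish[of M F "of_nat j"] assms that CHAR_p order_divides
    by blast
  have "inj_on (of_nat :: nat \<Rightarrow> 'a) {..<p}"
    by (auto simp: inj_on_def of_nat_eq_iff_cong_CHAR CHAR_p cong_def)
  then have "p * M = (\<Sum>x\<in>(of_nat ` {..<p} :: 'a set). M)"
    by (simp add: card_image)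
  also have "\<dots> \<le> (\<Sum>x\<in>of_nat ` {..<p}. order x F)"
    using ord by (intro sum_mono) auto
  also have "\<dots> \<le> (\<Sum>x | poly F x = 0. order x F)"
  proof (rule sum_mono2[OF poly_roots_finite[OF assms(1)]])
    show "of_nat ` {..<p} \<subseteq> {x. poly F x = 0}"
      using assms(3)[of _ 0] False by auto
  qed simp
  also have "\<dots> \<le> degree F"
    by (rule sum_order_le_degree) fact
  finally show ?thesis .
qed simp

text \<open>Meant for polynomials in \<open>X ^ p\<close>, which differentiation treats as
  constants.\<close>

lemma higher_pderiv_mult_constant:
  fixes D f :: "'a poly"
  assumes "pderiv D = 0"
  shows "(pderiv ^^ k) (D * f) = D * (pderiv ^^ k) f"
  using assms by (induction k) (simp_all add: pderiv_mult)

text \<open>One more than the bound \<open>(3 * n - 1) + (B - 1) + k * (2 * n - 1)\<close> on the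
  degree of \<open>monom 1 j * W c k\<close> below, hence the number of coefficients to
  annihilate.\<close>

definition L :: "nat \<Rightarrow> nat" where
  "L k = B + 3 * n - 1 + k * (2 * n - 1)"

text \<open>
  The auxiliary polynomial combines the \<open>p\<close> functions \<open>(X + a) ^ b * G i\<close>, one for each residue of the
  order at \<open>- a\<close> modulo \<open>p\<close>, with coefficients that are polynomials in \<open>X ^ p\<close> of degree below \<open>3 n\<close>; the
  distinct orders make it nonzero. On the prime field \<open>X ^ p\<close> agrees with \<open>X\<close>, and \<open>G i\<close> with the
  \<open>i\<close>-th power of an element of \<open>T\<close>, so the vanishing of the \<open>k\<close>-th derivative there costs at most
  \<open>card T * L k\<close> linear conditions.
\<close>
theorem stepanov: "3 * n * p \<le> card T * (\<Sum>k<4*n. L k)"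
proof (rule ccontr)
  assume contra: "\<not> ?thesis"
  obtain ii bb where ib: "\<And>c. c < p \<Longrightarrow> ii c < d \<and> bb c < B \<and> (bb c + E (ii c)) mod p = c"
    using residue_cover by metis
  define K where "K c = [:a, 1:] ^ bb c * G (ii c)" for c
  have "\<exists>W. degree W \<le> bb c + k * (2 * n - 1) \<and> h ^ k * (pderiv ^^ k) (K c) = G (ii c) * W" for c k
    unfolding K_def by (rule higher_derivative_G)
  then obtain W where W: "\<And>c k. degree (W c k) \<le> bb c + k * (2 * n - 1)"
    "\<And>c k. h ^ k * (pderiv ^^ k) (K c) = G (ii c) * W c k"
    by metis
  \<comment> \<open>\<open>U\<close> indexes the unknown coefficients of \<open>X ^ (p * j)\<close>
    in \<open>D c\<close>. \<open>Eq\<close> indexes the conditions by value in \<open>T\<close>,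
    order of derivative and coefficient.\<close>
  define U where "U = {..<p} \<times> {..<3*n}"
  define Eq where "Eq = (SIGMA \<rho>:T. SIGMA k:{..<4*n}. {..<L k})"
  define M where "M = (\<lambda>(\<rho>, k, t) (c, j). \<rho> ^ ii c * coeff (monom 1 j * W c k) t)"
  have "card Eq < card U"
    using contra by (simp add: Eq_def U_def card_SigmaI mult_ac)
  then obtain y where y: "\<exists>x\<in>U. y x \<noteq> 0" "\<And>e. e \<in> Eq \<Longrightarrow> (\<Sum>x\<in>U. M e x * y x) = 0"
    using exists_nontrivial_solution[of U Eq M] by (auto simp: U_def Eq_def)
  define D where "D c = (\<Sum>j<3*n. monom (y (c, j)) (p * j))" for c
  define F where "F = (\<Sum>c<p. D c * K c)"
  have coeff_D: "coeff (D c) (p * j) = y (c, j)" if "j < 3 * n" for c j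
    using that p_gt_1 by (simp add: D_def coeff_sum if_distrib sum.delta cong: if_cong)
  have "of_nat (p * j) = (0 :: 'a)" for j
    by (simp add: of_nat_eq_0_iff_char_dvd CHAR_p)
  then have pderiv_D: "pderiv (D c) = 0" for c
    by (simp add: D_def higher_pderiv_sum[of 1, simplified] pderiv_monom del: of_nat_mult)
  have K_nonzero: "K c \<noteq> 0" for c
    by (simp add: K_def G_nonzero)
  have order_K: "order (- a) (K c) mod p = c" if "c < p" for c
  proof -
    have "order (- a) (K c) = bb c + E (ii c) mod p"
      using K_nonzero[of c] order_power_n_n[of "- a" "bb c"] by (simp add: K_def order_mult order_G)
    then show ?thesis
      using ib[OF that] by (simp add: mod_simps)
  qed
  have "F \<noteq> 0"
    unfolding F_def
  proof (rule sum_nonzero_if_orders_distinct[where x = "- a"])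
    \<comment> \<open>\<open>D c\<close> contributes a multiple of \<open>p\<close>, so the residue
      \<open>c\<close> coming from \<open>K c\<close> survives.\<close>
    have "order (- a) (D c * K c) mod p = c" if "c < p" "D c * K c \<noteq> 0" for c
    proof -
      have "p dvd order (- a) (D c)"
        using CHAR_dvd_order_if_pderiv_eq_0[OF pderiv_D] that CHAR_p by auto
      then show ?thesis
        using that order_K[OF that(1)] by (auto simp: order_mult mod_add_left_eq[symmetric] elim!: dvdE)
    qed
    then show "inj_on (\<lambda>c. order (- a) (D c * K c)) {c \<in> {..<p}. D c * K c \<noteq> 0}"
      by (intro inj_onI) (metis (mono_tags, lifting) lessThan_iff mem_Collect_eq)
    obtain c j where "c < p" "j < 3 * n" "y (c, j) \<noteq> 0"
      using y(1) by (auto simp: U_def)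
    then show "\<exists>c\<in>{..<p}. D c * K c \<noteq> 0"
      using coeff_D[of j c] K_nonzero[of c] by (intro bexI[of _ c]) auto
  qed simp
  moreover have "poly ((pderiv ^^ k) F) (of_nat i) = 0" if i: "i < p" and k: "k < 4 * n" for i k
  proof -
    define x :: 'a where "x = of_nat i"
    define \<rho> where "\<rho> = (x + a) ^ ((q - 1) * u)"
    have \<rho>: "\<rho> \<in> T"
      using T[OF i] by (simp add: \<rho>_def x_def)
    \<comment> \<open>\<open>H\<close> is what \<open>h ^ k\<close> times the \<open>k\<close>-th
      derivative becomes once \<open>X ^ p\<close> is read as \<open>X\<close> and
      \<open>G (ii c)\<close> as a power of \<open>\<rho>\<close>. The linear system makes it zero
      as a polynomial.\<close>
    define H where "H = (\<Sum>(c, j)\<in>U. smult (y (c, j) * \<rho> ^ ii c) (monom 1 j * W c k))"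
    have "H = 0"
    proof (rule poly_eqI)
      fix t
      show "coeff H t = coeff 0 t"
      proof (cases "t < L k")
        case True
        then have "(\<rho>, k, t) \<in> Eq"
          using \<rho> k by (simp add: Eq_def)
        then have "(\<Sum>x\<in>U. M (\<rho>, k, t) x * y x) = 0"
          by (rule y(2))
        then show ?thesis
          unfolding H_def M_def by (simp add: coeff_sum case_prod_unfold mult_ac)
      next
        case False
        have "coeff (monom 1 j * W c k) t = 0" if "c < p" "j < 3 * n" for c j
        proof (rule coeff_eq_0)
          have "degree (monom 1 j * W c k) \<le> j + (bb c + k * (2 * n - 1))"
            using degree_mult_le[of "monom 1 j" "W c k"] W(1)[of c k] degree_monom_le[of "1 :: 'a" j]
            by linarith
          also have "\<dots> < L k"
            unfolding L_def using ib[OF that(1)] that(2) by linarith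
          finally show "degree (monom 1 j * W c k) < t"
            using False by simp
        qed
        then show ?thesis
          unfolding H_def U_def by (auto simp: coeff_sum intro!: sum.neutral)
      qed
    qed
    have "x ^ p = x"
      using of_nat_power_p[of i 1] by (simp add: x_def)
    then have poly_D: "poly (D c) x = (\<Sum>j<3*n. y (c, j) * x ^ j)" for c
      by (simp add: D_def poly_sum poly_monom power_mult)
    have "poly h x ^ k * poly ((pderiv ^^ k) F) x = poly (\<Sum>c<p. D c * (h ^ k * (pderiv ^^ k) (K c))) x"
      unfolding F_def higher_pderiv_sum higher_pderiv_mult_constant[OF pderiv_D]
      by (simp add: poly_sum sum_distrib_left mult_ac)
    also have "\<dots> = (\<Sum>c<p. poly (D c) x * (\<rho> ^ ii c * poly (W c k) x))"
      unfolding W(2) poly_sum using ib by (intro sum.cong) (simp_all add: poly_G x_def \<rho>_def)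
    also have "\<dots> = (\<Sum>c<p. \<Sum>j<3*n. y (c, j) * x ^ j * (\<rho> ^ ii c * poly (W c k) x))"
      by (simp add: poly_D sum_distrib_right)
    also have "\<dots> = poly H x"
      by (simp add: H_def U_def poly_sum poly_monom sum.cartesian_product case_prod_unfold mult_ac)
    finally show ?thesis
      using \<open>H = 0\<close> poly_h_nonzero[of i] by (simp add: x_def)
  qed
  ultimately have "p * (4 * n) \<le> degree F"
    using prime_subfield_roots_bound[of F "4 * n"] four_n_le by blast
  \<comment> \<open>The halved degree of \<open>G\<close> is decisive:
    \<open>p * (3 * n - 1) + (B - 1) + n * (p - 1)\<close> stays below \<open>4 * n * p\<close>
    because \<open>B \<le> p\<close>.\<close>
  moreover have "degree F < p * (4 * n)"
  proof -
    have "degree F \<le> p * (3 * n - 1) + (B - 1 + n * (p - 1))"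
      unfolding F_def
    proof (rule degree_sum_le)
      fix c assume c: "c \<in> {..<p}"
      have "degree (D c) \<le> p * (3 * n - 1)"
        unfolding D_def
        by (intro degree_sum_le order_trans[OF degree_monom_le]) (auto intro!: mult_le_mono2)
      moreover have "degree (K c) \<le> B - 1 + n * (p - 1)"
      proof -
        have "degree ([:a, 1:] ^ bb c) = bb c"
          by (simp add: degree_power_eq)
        moreover have "ii c < d" "bb c < B"
          using ib c by auto
        ultimately show ?thesis
          unfolding K_def
          using degree_mult_le[of "[:a, 1:] ^ bb c" "G (ii c)"] degree_G[of "ii c"] by linarith
      qed
      ultimately show "degree (D c * K c) \<le> p * (3 * n - 1) + (B - 1 + n * (p - 1))"
        using degree_mult_le[of "D c" "K c"] by linarith
    qed simp
    also have "\<dots> < p * (4 * n)"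
    proof -
      obtain n' p' where "n = Suc n'" "p = Suc p'"
        using n_pos p_gt_1 by (cases n; cases p) auto
      then show ?thesis
        using B_le_p by (simp add: algebra_simps)
    qed
    finally show ?thesis .
  qed
  ultimately show False
    by simp
qed

lemma sum_L: "(\<Sum>k<4*n. L k) = n * (4 * (p div d) + 16 * n\<^sup>2 + 2)"
proof -
  obtain t where t: "n = Suc t"
    using n_pos by (cases n) auto
  have "(\<Sum>k<m. c + k * e) = m * c + e * (\<Sum>k<m. k)" for m c e :: nat
    by (simp add: sum.distrib sum_distrib_left mult.commute)
  then have "(\<Sum>k<4*n. L k) = 4 * n * (B + 3 * n - 1) + (2 * n - 1) * (\<Sum>k<4*n. k)"
    unfolding L_def .
  also have "(\<Sum>k<4*n. k) = 2 * n * (4 * n - 1)"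
    using gauss_sum_nat[of "4 * n - 1"] n_pos by (simp add: lessThan_atLeast0 atLeastLessThanSuc_atLeastAtMost[symmetric])
  finally show ?thesis
    by (simp add: t B_def algebra_simps power2_eq_square)
qed

theorem card_bound: "3 * p \<le> card T * (4 * (p div d) + 16 * n\<^sup>2 + 2)"
proof -
  have "n * (3 * p) \<le> n * (card T * (4 * (p div d) + 16 * n\<^sup>2 + 2))"
    using stepanov unfolding sum_L by (simp only: mult_ac)
  then show ?thesis
    using n_pos by (simp only: mult_le_cancel1)
qed

end

subsection \<open>Conclusion\<close>

text \<open>Iterated Frobenius maps add their exponents, so a Bezout relation between
  \<open>l\<close> and \<open>m\<close> yields the gcd.\<close>

lemma power_fixed_gcd:
  fixes x :: "'a::monoid_mult"
  assumes "x ^ (p ^ l) = x" "x ^ (p ^ m) = x" "l > 0"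
  shows "x ^ (p ^ gcd l m) = x"
proof -
  have iterate: "x ^ (p ^ (k * t)) = x" if "x ^ (p ^ k) = x" for k t
    using that by (induction t) (simp_all add: power_add power_mult)
  obtain s t where st: "l * s = m * t + gcd l m"
    using bezout_nat[of l m] assms(3) by auto
  have "x ^ (p ^ gcd l m) = (x ^ (p ^ (m * t))) ^ (p ^ gcd l m)"
    using iterate[OF assms(2)] by simp
  also have "\<dots> = x ^ (p ^ (l * s))"
    by (simp add: st power_add flip: power_mult)
  finally show ?thesis
    using iterate[OF assms(1)] by simp
qed

lemma card_power_fixed_le:
  assumes "m > 1"
  shows "card {x :: 'a::{field, finite}. x ^ m = x} \<le> m"
proof -
  let ?f = "monom 1 m - [:0, 1:] :: 'a poly"
  have "coeff ?f 1 = -1"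
    using assms by simp
  then have "?f \<noteq> 0"
    by (metis coeff_0 neg_equal_0_iff_equal zero_neq_one)
  moreover have "degree ?f \<le> m"
    using assms by (intro degree_diff_le degree_monom_le) simp
  moreover have "{x. x ^ m = x} = {x. poly ?f x = 0}"
    by (simp add: poly_monom)
  ultimately show ?thesis
    using card_poly_roots_bound[of ?f] by simp
qed

section \<open>A point of \<open>A\<close> that differs from its conjugates\<close>

context quadratic_field
begin

lemma of_nat_mult_closed:
  assumes "0 \<in> B" "\<And>x y. x \<in> B \<Longrightarrow> y \<in> B \<Longrightarrow> x + y \<in> B" "x \<in> B"
  shows "of_nat k * x \<in> (B :: 'a set)"
  using assms by (induction k) (simp_all add: distrib_right)

text \<open>For \<open>c \<in> A' - B\<close> the translates of \<open>B\<close> by the prime-field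
  multiples of \<open>c\<close> are \<open>p\<close> disjoint subsets of \<open>A'\<close>.\<close>

lemma card_proper_subgroup_le:
  fixes B A' :: "'a set"
  assumes B: "0 \<in> B" "\<And>x y. x \<in> B \<Longrightarrow> y \<in> B \<Longrightarrow> x + y \<in> B"
    and A': "0 \<in> A'" "\<And>x y. x \<in> A' \<Longrightarrow> y \<in> A' \<Longrightarrow> x + y \<in> A'"
    and "B \<subset> A'"
  shows "p * card B \<le> card A'"
proof -
  obtain c where c: "c \<in> A'" "c \<notin> B"
    using assms by blast
  have neq: "b + of_nat i * c \<noteq> b' + of_nat j * c" if "b \<in> B" "b' \<in> B" "i < j" "j < p" for b b' i j
  proof
    assume eq: "b + of_nat i * c = b' + of_nat j * c"
    have "coprime (j - i) p"
      using that prime_p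
      by (metis coprime_commute diff_is_0_eq leD less_imp_diff_less nat_dvd_not_less prime_imp_coprime
          zero_less_diff)
    then obtain k where "[(j - i) * k = Suc 0] (mod p)"
      using cong_solve_coprime_nat by blast
    then have "of_nat ((j - i) * k) = (of_nat (Suc 0) :: 'a)"
      by (simp only: of_nat_eq_iff_cong_CHAR CHAR_p)
    then have "c = of_nat k * (of_nat (j - i) * c)"
      by (simp add: mult_ac)
    also have "of_nat (j - i) * c = b - b'"
      using eq that by (simp add: of_nat_diff algebra_simps)
    \<comment> \<open>Only closure under sums is available, so \<open>- b'\<close> is written as
      \<open>p - 1\<close> copies of \<open>b'\<close>.\<close>
    also have "\<dots> = b + of_nat (p - 1) * b'"
      using p_gt_1 of_nat_CHAR[where ?'a = 'a] CHAR_p by (simp add: of_nat_diff)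
    also have "of_nat k * \<dots> \<in> B"
      using that by (intro of_nat_mult_closed B)
    finally show False
      using c by simp
  qed
  have "inj_on (\<lambda>(i, b). b + of_nat i * c) ({..<p} \<times> B)"
    using neq by (auto simp: inj_on_def) (metis linorder_neqE_nat, metis add_right_cancel linorder_neqE_nat)
  moreover have "(\<lambda>(i, b). b + of_nat i * c) ` ({..<p} \<times> B) \<subseteq> A'"
    using assms c by (auto intro!: A'(2) of_nat_mult_closed[OF A'])
  ultimately have "card ({..<p} \<times> B) \<le> card A'"
    by (intro card_inj_on_le) auto
  then show ?thesis
    by simp
qed

text \<open>If \<open>Fix l = A\<close>, then \<open>A\<close> lies in the fixed points of the
  \<open>p ^ g\<close>-power map with \<open>g\<close> a proper divisor of \<open>2 * n\<close>; its
  size forces \<open>g = n\<close>, the excluded case. So each \<open>Fix l\<close> has at most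
  \<open>q / p\<close> elements, and \<open>2 * n - 1 < p\<close> of them cannot cover
  \<open>A\<close>.\<close>

lemma exists_generator:
  assumes closed: "0 \<in> A" "\<And>x y. x \<in> A \<Longrightarrow> y \<in> A \<Longrightarrow> x + y \<in> A"
    and "2 * n \<le> p" "A \<noteq> {x. x ^ q = x}"
  shows "\<exists>a\<in>A. \<forall>l. 0 < l \<longrightarrow> l < 2 * n \<longrightarrow> a ^ (p ^ l) \<noteq> a"
proof (rule ccontr)
  assume *: "\<not> ?thesis"
  define Fix where "Fix l = {x \<in> A. x ^ (p ^ l) = x}" for l
  have Fix_le: "p * card (Fix l) \<le> q" if l: "0 < l" "l < 2 * n" for l
  proof -
    have "Fix l \<noteq> A"
    proof
      assume "Fix l = A"
      have "x ^ (p ^ (2 * n)) = x" for x :: 'a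
        using power_q_q[of x] by (simp add: q_eq mult_2 power_add flip: power_mult)
      then have sub: "A \<subseteq> {x. x ^ (p ^ gcd l (2 * n)) = x}"
        using \<open>Fix l = A\<close> l power_fixed_gcd[of _ p l "2 * n"] by (auto simp: Fix_def)
      define g where "g = gcd l (2 * n)"
      have "g \<le> l"
        using l by (simp add: g_def)
      then have g: "g < 2 * n"
        using l by linarith
      have g': "0 < g" "g dvd 2 * n"
        using l by (simp_all add: g_def)
      have "p ^ n \<le> card {x :: 'a. x ^ (p ^ g) = x}"
        using card_mono[OF _ sub] card_A q_eq by (simp add: g_def)
      also have "\<dots> \<le> p ^ g"
        using g' p_gt_1 by (intro card_power_fixed_le one_less_power)
      finally have "n \<le> g"
        using p_gt_1 by (metis power_increasing_iff)
      obtain k where k: "2 * n = g * k"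
        using g'(2) by (elim dvdE)
      have "k > 1"
        using g k by (cases "k = 0 \<or> k = 1") auto
      then have "g * 2 \<le> g * k"
        by (intro mult_le_mono2) simp
      then have "g = n"
        using k \<open>n \<le> g\<close> by linarith
      then have "A \<subseteq> {x. x ^ q = x}"
        using sub by (simp add: g_def q_eq)
      moreover have "card {x :: 'a. x ^ q = x} \<le> card A"
        using card_power_fixed_le[OF q_gt_1] card_A by simp
      ultimately show False
        using assms by (metis card_seteq finite)
    qed
    then have "p * card (Fix l) \<le> card A"
      using p_gt_1 closed
      by (intro card_proper_subgroup_le) (auto simp: Fix_def add_power_p power_0_left)
    then show ?thesis
      by (simp add: card_A)
  qed
  have "A \<subseteq> (\<Union>l\<in>{0<..<2*n}. Fix l)"
    using * by (fastforce simp: Fix_def)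
  then have "q \<le> (\<Sum>l\<in>{0<..<2*n}. card (Fix l))"
    unfolding card_A[symmetric]
    by (intro order_trans[OF card_mono card_UN_le]) auto
  then have "p * q \<le> (\<Sum>l\<in>{0<..<2*n}. p * card (Fix l))"
    unfolding sum_distrib_left[symmetric] by (rule mult_le_mono2)
  also have "\<dots> \<le> (\<Sum>l\<in>{0<..<2*n}. q)"
    using Fix_le by (intro sum_mono) simp
  also have "\<dots> < 2 * n * q"
    using q_gt_1 n_pos by simp
  finally show False
    using assms(3) by simp
qed

end

text \<open>Since \<open>16 * n^2 + 2 \<le> 3/2 * (4 * n - 1)^2\<close>, the two inequalities give
  \<open>3 \<le> 4 * \<rho> + 3/2 * (1 - \<rho>)^2\<close> for \<open>\<rho> = r / d\<close>, which
  is false for \<open>0 < \<rho> \<le> 1/2\<close>.\<close>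

lemma numeric_contradiction:
  fixes n p d r c :: nat
  assumes "n \<ge> 2" "1 \<le> r" "2 * r \<le> d" "c \<le> r"
    and p: "(4 * real n - 1)\<^sup>2 * real r * (real d)\<^sup>2 \<le> real p * (real d - real r)\<^sup>2"
    and bound: "3 * p \<le> c * (4 * (p div d) + 16 * n\<^sup>2 + 2)"
  shows False
proof -
  define \<rho> where "\<rho> = real r / real d"
  have d: "real d > 0" and r: "real r > 0"
    using assms by auto
  have \<rho>: "0 < \<rho>" "\<rho> \<le> 1 / 2"
    using assms d r by (auto simp: \<rho>_def field_simps)
  have "(4 * real n - 1)\<^sup>2 * real r \<le> real p * (1 - \<rho>)\<^sup>2"
  proof -
    have "real p * (real d - real r)\<^sup>2 = real p * (1 - \<rho>)\<^sup>2 * (real d)\<^sup>2"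
      using d by (simp add: \<rho>_def power2_eq_square field_simps)
    then have "(4 * real n - 1)\<^sup>2 * real r * (real d)\<^sup>2 \<le> real p * (1 - \<rho>)\<^sup>2 * (real d)\<^sup>2"
      using p by linarith
    then show ?thesis
      by (rule mult_right_le_imp_le) (use d in simp)
  qed
  moreover have "16 * (real n)\<^sup>2 + 2 \<le> 3 / 2 * (4 * real n - 1)\<^sup>2"
  proof -
    have "2 * real n \<le> real n * real n"
      using assms(1) by (intro mult_right_mono) auto
    moreover have "(4 * real n - 1)\<^sup>2 = 16 * (real n * real n) - 8 * real n + 1"
      by (simp add: power2_eq_square algebra_simps)
    ultimately show ?thesis
      using assms(1) unfolding power2_eq_square[of "real n"] by linarith
  qed
  then have "real r * (16 * (real n)\<^sup>2 + 2) \<le> real r * (3 / 2 * (4 * real n - 1)\<^sup>2)"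
    by (rule mult_left_mono) simp
  then have "real r * (16 * (real n)\<^sup>2 + 2) \<le> 3 / 2 * ((4 * real n - 1)\<^sup>2 * real r)"
    by (simp only: mult_ac)
  moreover have "3 * real p \<le> 4 * real p * \<rho> + real r * (16 * (real n)\<^sup>2 + 2)"
  proof -
    have "3 * p \<le> r * (4 * (p div d) + 16 * n\<^sup>2 + 2)"
      using bound mult_le_mono1[OF assms(4)] order_trans by blast
    then have "real (3 * p) \<le> real (r * (4 * (p div d) + 16 * n\<^sup>2 + 2))"
      by (simp only: of_nat_le_iff)
    then have "3 * real p \<le> real r * (4 * real (p div d) + 16 * (real n)\<^sup>2 + 2)"
      by (simp only: of_nat_mult of_nat_add of_nat_numeral of_nat_power)
    also have "\<dots> \<le> real r * (4 * (real p / real d) + 16 * (real n)\<^sup>2 + 2)"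
      using r of_nat_div_le_of_nat[of p d, where 'a = real] by (intro mult_left_mono) auto
    finally show ?thesis
      by (simp add: \<rho>_def algebra_simps)
  qed
  ultimately have "3 * real p \<le> real p * (4 * \<rho> + 3 / 2 * (1 - \<rho>)\<^sup>2)"
    by (simp add: algebra_simps)
  moreover have "4 * \<rho> + 3 / 2 * (1 - \<rho>)\<^sup>2 < 3"
  proof -
    have "\<rho> * \<rho> \<le> 1 / 2 * (1 / 2)"
      using \<rho> by (intro mult_mono) auto
    moreover have "(1 - \<rho>)\<^sup>2 = 1 - 2 * \<rho> + \<rho> * \<rho>"
      by (simp add: power2_eq_square algebra_simps)
    ultimately show ?thesis
      using \<rho> by linarith
  qed
  moreover have "p > 0"
  proof (rule ccontr)
    assume "\<not> p > 0"
    then have "(4 * real n - 1)\<^sup>2 * real r * (real d)\<^sup>2 \<le> 0"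
      using p by simp
    moreover have "(4 * real n - 1)\<^sup>2 > 0"
      using assms(1) by simp
    ultimately show False
      using r d by (simp add: mult_le_0_iff)
  qed
  then have "real p * (4 * \<rho> + 3 / 2 * (1 - \<rho>)\<^sup>2) < real p * 3"
    using calculation(2) by (intro mult_strict_left_mono) auto
  ultimately show False
    by linarith
qed


theorem theorem1p8:
  fixes n d r p q :: nat
    and Fq H S A :: "'a::{field,finite} set"
    and \<C> :: "'a set set"
  assumes "n \<ge> 2" and "d \<ge> 2"
    and "1 \<le> r" and "real r \<le> real d / 2"
    and "Factorial_Ring.prime p" and "q = p ^ n"
    and "[int q = - 1] (mod int d)"
    and "real p \<ge> (4 * real n - 1)\<^sup>2 * real r * (real d)\<^sup>2 / (real d - real r)\<^sup>2"
    and "card (UNIV :: 'a set) = q\<^sup>2"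
    and "subfield Fq ring_of_type_algebra" and "card Fq = q"
    and "subgroup H mult_group" and "card (rcosets\<^bsub>mult_group\<^esub> H) = d"
    and "\<C> \<subseteq> rcosets\<^bsub>mult_group\<^esub> H" and "card \<C> = r" and "S = \<Union> \<C>"
    and "Fq - {0} \<subseteq> S"
    and "0 \<in> A" and "1 \<in> A" and "card A = q"
    and "{a - b | a b. a \<in> A \<and> b \<in> A} \<subseteq> S \<union> {0}"
  shows "A = Fq"
proof (rule ccontr)
  assume "A \<noteq> Fq"
  interpret quadratic_field p n q A
    using assms by unfold_locales auto
  define u where "u = (q + 1) div d"
  have "int d dvd int (q + 1)"
    using assms(7) by (simp add: cong_iff_dvd_diff add.commute)
  then have du: "d * u = q + 1"
    unfolding u_def of_nat_dvd_iff by simp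
  have u: "u > 0"
    using du by (cases u) auto
  have q2: "q\<^sup>2 - 1 = (q - 1) * u * d"
  proof -
    have "(q - 1) * u * d = (q - 1) * (d * u)"
      by (simp only: mult_ac)
    then show ?thesis
      unfolding du by (simp add: algebra_simps power2_eq_square diff_mult_distrib2)
  qed
  have rd: "2 * r \<le> d"
    using assms(4) by simp
  have p: "(4 * real n - 1)\<^sup>2 * real r * (real d)\<^sup>2 \<le> real p * (real d - real r)\<^sup>2"
    using assms(3,8) rd by (simp add: pos_divide_le_eq)
  \<comment> \<open>\<open>r * d^2 \<ge> (d - r)^2\<close> reduces the hypothesis to
    \<open>p \<ge> (4 * n - 1)^2\<close>.\<close>
  have p4: "4 * n \<le> p"
  proof -
    have "(4 * real n - 1)\<^sup>2 * (real d - real r)\<^sup>2 \<le> (4 * real n - 1)\<^sup>2 * (real r * (real d)\<^sup>2)"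
    proof (rule mult_left_mono)
      have "(real d - real r)\<^sup>2 \<le> (real d)\<^sup>2"
        using rd by (intro power_mono) auto
      also have "\<dots> \<le> real r * (real d)\<^sup>2"
        using assms(3) mult_right_mono[of 1 "real r" "(real d)\<^sup>2"] by simp
      finally show "(real d - real r)\<^sup>2 \<le> real r * (real d)\<^sup>2" .
    qed simp
    also have "\<dots> \<le> real p * (real d - real r)\<^sup>2"
      using p by (simp add: mult.assoc)
    finally have "(4 * real n - 1)\<^sup>2 \<le> real p"
      using rd assms(3) by simp
    moreover have "4 * real n \<le> (4 * real n - 1)\<^sup>2"
    proof -
      have "2 * real n \<le> real n * real n"
        using assms(1) by (intro mult_right_mono) auto
      moreover have "(4 * real n - 1)\<^sup>2 = 16 * (real n * real n) - 8 * real n + 1"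
        by (simp add: power2_eq_square algebra_simps)
      ultimately show ?thesis
        using assms(1) by linarith
    qed
    ultimately show ?thesis
      by linarith
  qed

  have field: "Ring.field (ring_of_type_algebra :: 'a ring)"
    by (rule field_from_type_algebra)
  have group: "Group.group (mult_group :: 'a monoid)"
    unfolding mult_group_def by (rule field.field_mult_group[OF field])
  have carrier: "carrier (mult_group :: 'a monoid) = UNIV - {0}"
    and mult: "x \<otimes>\<^bsub>mult_group\<^esub> y = x * y" for x y :: 'a
    by (simp_all add: mult_group_def ring_of_type_algebra_def)
  have "card (rcosets\<^bsub>mult_group\<^esub> H) * card H = Coset.order (mult_group :: 'a monoid)"
    by (rule group.lagrange[OF group assms(12)])
  then have card_H: "card H = (q - 1) * u"
    using assms(2,13) q2 by (simp add: Coset.order_def carrier card_UNIV)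
  have H_sub: "H \<subseteq> UNIV - {0}"
    using subgroup.subset[OF assms(12)] by (simp add: carrier)
  have power_H: "x ^ card H = 1" if "x \<in> H" for x
    using H_sub subgroup.m_closed[OF assms(12)] that by (intro power_card_eq_1) (auto simp: mult)
  \<comment> \<open>The exponent is \<open>card H\<close>, so the power map is constant on each
    coset of \<open>H\<close>.\<close>
  define T where "T = (\<lambda>y. y ^ ((q - 1) * u)) ` S"
  have card_T: "card T \<le> r"
  proof -
    have coset: "card ((\<lambda>y. y ^ card H) ` C) \<le> 1" if C: "C \<in> \<C>" for C
    proof -
      obtain g where "C = H #>\<^bsub>mult_group\<^esub> g"
        using C assms(14) unfolding RCOSETS_def by blast
      then have "C = (\<lambda>h. h * g) ` H"
        by (auto simp: r_coset_def mult)
      then have "(\<lambda>y. y ^ card H) ` C \<subseteq> {g ^ card H}"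
        using power_H by (auto simp: power_mult_distrib)
      then show ?thesis
        using card_mono[of "{g ^ card H}"] by auto
    qed
    have "T = (\<Union>C\<in>\<C>. (\<lambda>y. y ^ card H) ` C)"
      by (simp add: T_def card_H assms(16) image_Union)
    also have "card \<dots> \<le> (\<Sum>C\<in>\<C>. card ((\<lambda>y. y ^ card H) ` C))"
      by (rule card_UN_le) simp
    also have "\<dots> \<le> (\<Sum>C\<in>\<C>. 1)"
      by (intro sum_mono coset)
    finally show ?thesis
      by (simp add: assms(15))
  qed
  have S: "a - b \<in> S" if "a \<in> A" "b \<in> A" "a \<noteq> b" for a b
  proof -
    have "a - b \<in> S \<union> {0}"
      using assms(21) that by blast
    then show ?thesis
      using that by simp
  qed
  have "D \<subseteq> (\<Union>t\<in>T. {v. v ^ u = inverse t})"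
  proof
    fix v assume "v \<in> D"
    then obtain a b where ab: "a \<in> A" "b \<in> A" "a \<noteq> b" "v = (a - b) / (a - b) ^ q"
      by (auto simp: D_iff)
    have "(a - b) ^ (q * u) = (a - b) ^ ((q - 1) * u) * (a - b) ^ u"
      using q_gt_1 by (cases q) (simp_all add: power_add)
    moreover have "v ^ u = (a - b) ^ u / (a - b) ^ (q * u)"
      by (simp only: ab(4) power_divide power_mult)
    ultimately have "v ^ u = inverse ((a - b) ^ ((q - 1) * u))"
      using ab(3) by (simp add: inverse_eq_divide)
    then show "v \<in> (\<Union>t\<in>T. {v. v ^ u = inverse t})"
      using S[OF ab(1-3)] by (auto simp: T_def)
  qed
  then have "card D \<le> card (\<Union>t\<in>T. {v. v ^ u = inverse t})"
    by (intro card_mono) auto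
  also have "\<dots> \<le> (\<Sum>t\<in>T. card {v. v ^ u = inverse t})"
    by (rule card_UN_le) simp
  also have "\<dots> \<le> (\<Sum>t\<in>T. u)"
    using u by (intro sum_mono card_power_roots_le)
  also have "\<dots> \<le> r * u"
    using card_T by simp
  finally have "2 * card D \<le> (2 * r) * u"
    by simp
  also have "\<dots> \<le> d * u"
    using rd by (rule mult_le_mono1)
  finally have closed: "a + b \<in> A" if "a \<in> A" "b \<in> A" for a b
    using that p4 assms by (intro add_closed_if_few_directions) (auto simp: du)

  have Fq: "Fq = {x. x ^ q = x}"
  proof (rule card_subset_eq)
    have ring: "subring Fq (ring_of_type_algebra :: 'a ring)"
      using assms(10) by (simp add: subfield_def subdomain_def subcring_def)
    have zero: "0 \<in> Fq"
      using subringE(2)[OF ring] by (simp add: ring_of_type_algebra_def)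
    show sub: "Fq \<subseteq> {x. x ^ q = x}"
    proof safe
      fix x assume "x \<in> Fq"
      show "x ^ q = x"
      proof (cases "x = 0")
        case False
        have "y * z \<in> Fq" if "y \<in> Fq" "z \<in> Fq" for y z
          using subringE(6)[OF ring that] by (simp add: ring_of_type_algebra_def)
        then have "x ^ card (Fq - {0}) = 1"
          using \<open>x \<in> Fq\<close> False by (intro power_card_eq_1) auto
        then have "x ^ (q - 1) = 1"
          using zero assms(11) by simp
        then have "x * x ^ (q - 1) = x"
          by simp
        then show ?thesis
          using q_gt_1 by (simp flip: power_Suc)
      qed (use q_gt_1 in auto)
    qed
    show "card Fq = card {x :: 'a. x ^ q = x}"
      using card_mono[OF _ sub] card_power_fixed_le[OF q_gt_1, where 'a = 'a] assms(11) by auto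
  qed simp
  have "2 * n \<le> p" "A \<noteq> {x. x ^ q = x}"
    using p4 \<open>A \<noteq> Fq\<close> Fq by auto
  then obtain a where a: "a \<in> A" "\<And>l. 0 < l \<Longrightarrow> l < 2 * n \<Longrightarrow> a ^ (p ^ l) \<noteq> a"
    using exists_generator[OF assms(18)] closed by blast
  interpret shifted_line p n q d u a T
  proof
    fix j
    \<comment> \<open>Additivity and \<open>0, 1 \<in> A\<close> put the prime field into
      \<open>A\<close>; hence \<open>of_nat j + a\<close> is a nonzero difference of points of
      \<open>A\<close> and lies in \<open>S\<close>.\<close>
    have "of_nat j \<in> A"
      using assms(18,19) closed by (induction j) auto
    then have "of_nat j + a \<in> A"
      using a closed by blast
    moreover have "of_nat j + a \<noteq> 0"
    proof
      assume "of_nat j + a = 0"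
      then have "a = 0 - of_nat j"
        by (simp add: eq_neg_iff_add_eq_0 add.commute)
      moreover have "(of_nat j :: 'a) ^ p = of_nat j"
        using p_gt_1 add_power_p[of _ _ 1] by (induction j) simp_all
      ultimately have "a ^ (p ^ 1) = a"
        using diff_power_p[of 0 "of_nat j" 1] p_gt_1 by simp
      then show False
        using a(2)[of 1] assms(1) by simp
    qed
    ultimately show "(of_nat j + a) ^ ((q - 1) * u) \<in> T"
      using S[of "of_nat j + a" 0] assms(18) by (auto simp: T_def)
  qed (use assms CHAR_p du p4 a in auto)
  show False
    using numeric_contradiction[OF assms(1,3) rd card_T p] card_bound by blast
qed

end
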